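(* Let $F$ be a field with algebraic closure $\overline{F}$, and let $A\in F^{r\times r}$ and $B\in F^{s\times s}$. Then (a) $\displaystyle\sum_{\alpha\in\overline{F}}k_{A,\alpha}k_{B,\alpha}\le\dim(C(A,B))\le\sum_{\alpha\in\overline{F}}m_{A,\alpha}m_{B,\alpha}$; and (b) $(r-\mathrm{Rk}(A))(s-\mathrm{Rk}(B))\le\dim(C(A,B))\le(r-\mathrm{Rk}(A))(s-\mathrm{Rk}(B))+\mathrm{Rk}(A)\mathrm{Rk}(B)$.
   Context: $C(A,B):=\{X\in F^{r\times s}\mid AX=XB\}$. Regarding $A$ as acting on an $r$-dimensional vector space over $\overline{F}$, $k_{A,\alpha}$ and $m_{A,\alpha}$ denote the dimensions of the $\alpha$-eigenspace and of the generalized $\alpha$-eigenspace of $A$, respectively (so $c_A(t)=\prod_\alpha(t-\alpha)^{m_{A,\alpha}}$, with only finitely many nonzero terms); similarly for $B$. $\mathrm{Rk}(A)$ denotes the rank of $A$. *)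

theory Defs
  imports "Jordan_Normal_Form.Jordan_Normal_Form_Uniqueness" "Jordan_Normal_Form.DL_Rank"
    "HOL-Algebra.Algebraic_Closure_Type"
begin

definition C_space :: "'a::field mat \<Rightarrow> 'a mat \<Rightarrow> 'a mat set" where
  "C_space A B = {Y. Y \<in> carrier_mat (dim_row A) (dim_row B) \<and> A * Y = Y * B}"

definition dim_C :: "'a::field mat \<Rightarrow> 'a mat \<Rightarrow> nat" where
  "dim_C A B = vectorspace.dim class_ring
      ((module_mat TYPE('a) (dim_row A) (dim_row B))\<lparr>carrier := C_space A B\<rparr>)"

definition k_eig :: "'a::field mat \<Rightarrow> 'a alg_closure \<Rightarrow> nat" where
  "k_eig A \<alpha> = kernel_dim (char_matrix (map_mat to_ac A) \<alpha>)"

definition m_eig :: "'a::field mat \<Rightarrow> 'a alg_closure \<Rightarrow> nat" where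
  "m_eig A \<alpha> = dim_gen_eigenspace (map_mat to_ac A) \<alpha> (dim_row A)"

definition Rk :: "'a::field mat \<Rightarrow> nat" where
  "Rk A = vec_space.rank (dim_row A) A"

end

theory Submission
  imports Defs "Jordan_Normal_Form.Jordan_Normal_Form_Existence"
begin

text \<open>All four bounds come from explicit linear coordinates on \<open>C(A,B)\<close>.

  Rank bounds. Write \<open>A = P D\<^sub>a Q\<close> and \<open>B = R D\<^sub>b S\<close> with \<open>D\<^sub>k = diag(1,\<dots>,1,0,\<dots>,0)\<close> of rank \<open>k\<close>. The \<open>Y\<close> with
  \<open>A Y = 0 = Y B\<close> are those for which \<open>Q Y R\<close> lives in the lower right \<open>(r-a) \<times> (s-b)\<close> corner. For
  general \<open>Y \<in> C(A,B)\<close> the matrix \<open>A Y = Y B\<close> is described by an \<open>a \<times> b\<close> block, and \<open>Y\<close> is determined by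
  this block together with the corner of \<open>Q Y R\<close>.

  Eigenvalue bounds. \<open>C(A,B)\<close> is the kernel of a matrix with entries in \<open>F\<close>, so its dimension does not
  change over the algebraic closure, where \<open>A\<close> and \<open>B\<close> may be replaced by Jordan matrices \<open>J\<close> and \<open>K\<close>.
  Since these are upper triangular, a solution of \<open>J Y = Y K\<close> is determined by its entries at the
  positions \<open>(i,j)\<close> with \<open>J\<^sub>i\<^sub>i = K\<^sub>j\<^sub>j\<close>. Conversely, the matrix unit at \<open>(i,j)\<close> is a solution if \<open>i\<close> starts a
  block of \<open>J\<close> and \<open>j\<close> ends a block of \<open>K\<close> with the same eigenvalue.\<close>

no_notation fps_nth (infixl \<open>$\<close> 75)

section \<open>Dimension via coordinates\<close>

text \<open>A combination of the image of \<open>B\<close> with coefficients \<open>a\<close> is the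
  image of the combination of \<open>B\<close> with coefficients \<open>a \<circ> T\<close>.
  Injectivity makes the latter vanish, and independence of \<open>B\<close> kills its
  coefficients.\<close>

lemma (in linear_map) inj_image_lin_indpt:
  assumes inj: "inj_on T (carrier V)" and B: "B \<subseteq> carrier V" "finite B"
    and li: "V.module.lin_indpt B"
  shows "W.module.lin_indpt (T ` B)"
proof (rule W.module.finite_lin_indpt2)
  show "finite (T ` B)" "T ` B \<subseteq> carrier W" using B by auto
  fix a assume a: "a \<in> T ` B \<rightarrow> carrier K" and lc: "W.module.lincomb a (T ` B) = \<zero>\<^bsub>W\<^esub>"
  have aT: "a \<circ> T \<in> B \<rightarrow> carrier K" using a by auto
  have "T (V.module.lincomb (a \<circ> T) B) = T \<zero>\<^bsub>V\<^esub>"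
    using lincomb_linear_image[OF inj B(1) a B(2)] lc by simp
  hence "V.module.lincomb (a \<circ> T) B = \<zero>\<^bsub>V\<^esub>"
    by (rule inj_onD[OF inj]) (use V.module.lincomb_closed[OF B(1) aT] in auto)
  from V.not_lindepD[OF li B(2) order.refl aT this]
  show "\<forall>v\<in>T ` B. a v = \<zero>\<^bsub>K\<^esub>" by auto
qed

text \<open>Finite dimension of \<open>V\<close> is part of the conclusion. Independent sets of
  \<open>V\<close> are carried injectively to independent sets of \<open>W\<close>, so their size is
  bounded by \<open>W.dim\<close>; hence a maximal one exists and is a basis.\<close>

lemma (in linear_map) trivial_ker_dim_le:
  assumes ker: "\<And>x. x \<in> carrier V \<Longrightarrow> T x = \<zero>\<^bsub>W\<^esub> \<Longrightarrow> x = \<zero>\<^bsub>V\<^esub>" and fd: "W.fin_dim"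
  shows "V.fin_dim" "V.dim \<le> W.dim"
proof -
  have inj: "inj_on T (carrier V)"
    by (rule Ke0_imp_inj) (use ker in \<open>auto simp: ker_def\<close>)
  have bound: "card B \<le> W.dim" if B: "B \<subseteq> carrier V" "finite B" "V.module.lin_indpt B" for B
  proof -
    have "card B = card (T ` B)"
      using B(1) inj by (metis card_image inj_on_subset)
    also have "\<dots> \<le> W.dim"
      using W.li_le_dim(2)[OF fd _ inj_image_lin_indpt[OF inj B]] B(1) by auto
    finally show ?thesis .
  qed
  define Q where "Q = (\<lambda>S. S \<subseteq> carrier V \<and> finite S \<and> V.module.lin_indpt S)"
  have "\<exists>B. finite B \<and> maximal B Q"
  proof (rule maximal_exists)
    show "Q {}" unfolding Q_def V.module.lin_dep_def by auto
  qed (use bound in \<open>auto simp: Q_def\<close>)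
  then obtain B where B: "finite B" "maximal B Q" by blast
  have QB: "Q B" using B(2) by (simp add: maximal_def)
  \<comment> \<open>Maximality among finite independent sets passes to all independent sets: a
    strictly larger one would contain \<open>insert x B\<close>, which is still finite and
    independent.\<close>
  have "maximal B (\<lambda>S. S \<subseteq> carrier V \<and> V.module.lin_indpt S)"
    unfolding maximal_def
  proof (intro conjI allI impI)
    fix C assume C: "B \<subseteq> C \<and> C \<subseteq> carrier V \<and> V.module.lin_indpt C"
    show "C = B"
    proof (rule ccontr)
      assume "C \<noteq> B"
      then obtain x where x: "x \<in> C" "x \<notin> B" using C by blast
      have "V.module.lin_indpt (insert x B)"
        using V.module.subset_li_is_li[of C "insert x B"] C x by auto
      hence "Q (insert x B)" using C x B(1) by (auto simp: Q_def)
      thus False using B(2) x(2) unfolding maximal_def by blast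
    qed
  qed (use QB in \<open>auto simp: Q_def\<close>)
  hence bas: "V.basis B" by (rule V.max_li_is_basis)
  thus "V.fin_dim" unfolding V.fin_dim_def V.basis_def using B(1) by auto
  have "V.dim = card B" using V.dim_basis[OF B(1) bas] .
  thus "V.dim \<le> W.dim" using bound[of B] QB by (auto simp: Q_def)
qed

lemma linear_mapI:
  assumes "vectorspace K V" "vectorspace K W" "T \<in> module_hom K V W"
  shows "linear_map K V W T"
  using assms unfolding linear_map_def mod_hom_def mod_hom_axioms_def vectorspace_def by auto

text \<open>The functionals \<open>f _ i\<close> with \<open>i\<close> in \<open>S\<close> form an
  injective linear map into a coordinate space of dimension \<open>card S\<close>. The index set is
  arbitrary, so that sets of matrix positions can serve directly as coordinates.\<close>

lemma vectorspace_dim_le_coords: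
  fixes V :: "('a::field, 'v, 'm) module_scheme" and f :: "'v \<Rightarrow> 's \<Rightarrow> 'a"
  assumes V: "vectorspace class_ring V" and S: "finite S"
    and add: "\<And>x y i. x \<in> carrier V \<Longrightarrow> y \<in> carrier V \<Longrightarrow> i \<in> S \<Longrightarrow> f (x \<oplus>\<^bsub>V\<^esub> y) i = f x i + f y i"
    and smult: "\<And>c x i. x \<in> carrier V \<Longrightarrow> i \<in> S \<Longrightarrow> f (c \<odot>\<^bsub>V\<^esub> x) i = c * f x i"
    and inj: "\<And>x. x \<in> carrier V \<Longrightarrow> (\<And>i. i \<in> S \<Longrightarrow> f x i = 0) \<Longrightarrow> x = \<zero>\<^bsub>V\<^esub>"
  shows "vectorspace.fin_dim class_ring V" "vectorspace.dim class_ring V \<le> card S"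
proof -
  obtain h where h: "bij_betw h {0..<card S} S" using ex_bij_betw_nat_finite[OF S] by blast
  hence hS: "h i \<in> S" if "i < card S" for i using that by (auto simp: bij_betw_def)
  define T where "T = (\<lambda>x. vec (card S) (\<lambda>i. f x (h i)))"
  interpret F: vec_space "TYPE('a)" "card S" .
  have lin: "linear_map class_ring V F.V T"
    by (rule linear_mapI[OF V vec_vs])
       (auto simp: module_hom_def T_def module_vec_simps add smult hS)
  interpret L: linear_map class_ring V F.V T by (rule lin)
  have "x = \<zero>\<^bsub>V\<^esub>" if x: "x \<in> carrier V" and Tx: "T x = \<zero>\<^bsub>F.V\<^esub>" for x
  proof (rule inj[OF x])
    fix i assume "i \<in> S"
    then obtain j where j: "j < card S" "i = h j"
      using h by (metis atLeastLessThan_iff bij_betw_iff_bijections)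
    show "f x i = 0"
      using arg_cong[OF Tx, of "\<lambda>v. v $ j"] j by (simp add: T_def module_vec_simps)
  qed
  from L.trivial_ker_dim_le[OF this F.fin_dim] F.dim_is_n
  show "vectorspace.fin_dim class_ring V" "vectorspace.dim class_ring V \<le> card S" by auto
qed

text \<open>Dual to the upper bound: \<open>g\<close> is a linear parametrisation from which the
  parameters in \<open>S\<close> can be recovered, so a coordinate space of dimension
  \<open>card S\<close> embeds into \<open>V\<close>.\<close>

lemma vectorspace_dim_ge_coords:
  fixes V :: "('a::field, 'v, 'm) module_scheme" and g :: "('s \<Rightarrow> 'a) \<Rightarrow> 'v"
  assumes V: "vectorspace class_ring V" and fd: "vectorspace.fin_dim class_ring V"
    and S: "finite S"
    and carr: "\<And>c. g c \<in> carrier V"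
    and add: "\<And>c d. g (\<lambda>i. c i + d i) = g c \<oplus>\<^bsub>V\<^esub> g d"
    and smult: "\<And>k c. g (\<lambda>i. k * c i) = k \<odot>\<^bsub>V\<^esub> g c"
    and inj: "\<And>c i. g c = \<zero>\<^bsub>V\<^esub> \<Longrightarrow> i \<in> S \<Longrightarrow> c i = 0"
  shows "card S \<le> vectorspace.dim class_ring V"
proof -
  obtain h where h: "bij_betw h S {0..<card S}" using ex_bij_betw_finite_nat[OF S] by blast
  hence hS: "h i < card S" if "i \<in> S" for i using that by (auto simp: bij_betw_def)
  interpret F: vec_space "TYPE('a)" "card S" .
  \<comment> \<open>Parameters outside \<open>S\<close> are set to 0, which makes \<open>c\<close>
    additive and homogeneous as an equation between total functions.\<close>
  define c where "c = (\<lambda>v i. if i \<in> S then (v :: 'a vec) $ (h i) else 0)"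
  define T where "T = (\<lambda>v. g (c v))"
  have cadd: "c (v + w) = (\<lambda>i. c v i + c w i)" if "v \<in> carrier_vec (card S)" "w \<in> carrier_vec (card S)" for v w
    using that hS by (auto simp: c_def)
  have csmult: "c (k \<cdot>\<^sub>v v) = (\<lambda>i. k * c v i)" if "v \<in> carrier_vec (card S)" for k v
    using that hS by (auto simp: c_def)
  have lin: "linear_map class_ring F.V V T"
    by (rule linear_mapI[OF vec_vs V])
       (auto simp: module_hom_def T_def module_vec_simps carr cadd csmult add smult)
  interpret L: linear_map class_ring F.V V T by (rule lin)
  have "x = 0\<^sub>v (card S)" if x: "x \<in> carrier_vec (card S)" and Tx: "T x = \<zero>\<^bsub>V\<^esub>" for x
  proof -
    have "x $ i = 0" if i: "i < card S" for i
    proof -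
      obtain j where "j \<in> S" "h j = i" using h i by (metis atLeastLessThan_iff bij_betw_iff_bijections zero_le)
      thus ?thesis using inj[OF Tx[unfolded T_def], of j] by (simp add: c_def)
    qed
    thus ?thesis using x by auto
  qed
  thus ?thesis
    using L.trivial_ker_dim_le(2)[OF _ fd] F.dim_is_n by (simp add: module_vec_simps)
qed

section \<open>The space C(A,B) and coordinate bounds for its dimension\<close>

lemma C_space_vectorspace:
  fixes A B :: "'a::field mat"
  assumes A: "A \<in> carrier_mat r r" and B: "B \<in> carrier_mat s s"
  shows "vectorspace class_ring ((module_mat TYPE('a) r s)\<lparr>carrier := C_space A B\<rparr>)"
proof -
  interpret M: vectorspace "class_ring :: 'a ring" "module_mat TYPE('a) r s" by (rule matrix_vs)
  have "submodule class_ring (C_space A B) (module_mat TYPE('a) r s)"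
  proof (unfold_locales, goal_cases)
    case 1
    then show ?case using A B by (auto simp: C_space_def module_mat_simps)
  next
    case (2 v w)
    then show ?case using A B
      by (auto simp: C_space_def module_mat_simps mult_add_distrib_mat[of A r r] add_mult_distrib_mat[of _ r s _ B])
  next
    case 3
    then show ?case using A B by (auto simp: C_space_def module_mat_simps)
  next
    case (4 c v)
    then show ?case using A B
      by (auto simp: C_space_def module_mat_simps mult_smult_distrib[of A r r] mult_smult_assoc_mat[of _ r s B])
  qed
  from M.submodule_is_module[OF this] show ?thesis
    by (intro vectorspace.intro class_field)
qed

lemma dim_C_le:
  fixes A B :: "'a::field mat" and f :: "'a mat \<Rightarrow> 's \<Rightarrow> 'a"
  assumes A: "A \<in> carrier_mat r r" and B: "B \<in> carrier_mat s s" and S: "finite S"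
    and add: "\<And>Y Z i. Y \<in> carrier_mat r s \<Longrightarrow> Z \<in> carrier_mat r s \<Longrightarrow> i \<in> S \<Longrightarrow> f (Y + Z) i = f Y i + f Z i"
    and smult: "\<And>c Y i. Y \<in> carrier_mat r s \<Longrightarrow> i \<in> S \<Longrightarrow> f (c \<cdot>\<^sub>m Y) i = c * f Y i"
    and inj: "\<And>Y. Y \<in> carrier_mat r s \<Longrightarrow> A * Y = Y * B \<Longrightarrow> (\<And>i. i \<in> S \<Longrightarrow> f Y i = 0) \<Longrightarrow> Y = 0\<^sub>m r s"
  shows "vectorspace.fin_dim class_ring ((module_mat TYPE('a) r s)\<lparr>carrier := C_space A B\<rparr>)"
    "dim_C A B \<le> card S"
proof -
  have d: "dim_row A = r" "dim_row B = s" using A B by auto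
  note * = vectorspace_dim_le_coords[OF C_space_vectorspace[OF A B] S, of f]
  show "vectorspace.fin_dim class_ring ((module_mat TYPE('a) r s)\<lparr>carrier := C_space A B\<rparr>)"
    by (rule *(1)) (auto simp: C_space_def d module_mat_simps add smult inj)
  show "dim_C A B \<le> card S" unfolding dim_C_def d
    by (rule *(2)) (auto simp: C_space_def d module_mat_simps add smult inj)
qed

lemma C_space_fin_dim:
  fixes A B :: "'a::field mat"
  assumes A: "A \<in> carrier_mat r r" and B: "B \<in> carrier_mat s s"
  shows "vectorspace.fin_dim class_ring ((module_mat TYPE('a) r s)\<lparr>carrier := C_space A B\<rparr>)"
  by (rule dim_C_le(1)[OF A B, of "{..<r} \<times> {..<s}" "\<lambda>Y ij. Y $$ ij"]) auto

lemma dim_C_ge: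
  fixes A B :: "'a::field mat" and g :: "('s \<Rightarrow> 'a) \<Rightarrow> 'a mat"
  assumes A: "A \<in> carrier_mat r r" and B: "B \<in> carrier_mat s s" and S: "finite S"
    and carr: "\<And>c. g c \<in> carrier_mat r s" and comm: "\<And>c. A * g c = g c * B"
    and add: "\<And>c d. g (\<lambda>i. c i + d i) = g c + g d"
    and smult: "\<And>k c. g (\<lambda>i. k * c i) = k \<cdot>\<^sub>m g c"
    and inj: "\<And>c i. g c = 0\<^sub>m r s \<Longrightarrow> i \<in> S \<Longrightarrow> c i = 0"
  shows "card S \<le> dim_C A B"
proof -
  have d: "dim_row A = r" "dim_row B = s" using A B by auto
  show ?thesis unfolding dim_C_def d
    by (rule vectorspace_dim_ge_coords[OF C_space_vectorspace[OF A B] C_space_fin_dim[OF A B] S, of g])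
       (use inj in \<open>auto simp: C_space_def d module_mat_simps carr comm add smult\<close>)
qed

section \<open>Rank normal form\<close>

text \<open>Premises in terms of \<open>dim_row\<close> and \<open>dim_col\<close> leave no
  dimension to be guessed, so the equation works as a rewrite rule that nests products to the
  right.\<close>

lemma mat_assoc:
  "dim_col A = dim_row B \<Longrightarrow> dim_col B = dim_row C \<Longrightarrow> (A * B) * C = A * (B * C :: 'a::semiring_0 mat)"
  by (rule assoc_mult_mat[of A "dim_row A" "dim_col A" B "dim_col B" C "dim_col C"]) auto

definition rank_nf :: "nat \<Rightarrow> nat \<Rightarrow> nat \<Rightarrow> 'a::{zero,one} mat" where
  "rank_nf m n k = mat m n (\<lambda>(i,j). if i = j \<and> i < k then 1 else 0)"

lemma rank_nf_carrier[simp]: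
  "rank_nf m n k \<in> carrier_mat m n" "dim_row (rank_nf m n k) = m" "dim_col (rank_nf m n k) = n"
  by (simp_all add: rank_nf_def)

lemma rank_nf_Suc:
  "rank_nf (Suc m) (Suc n) (Suc k)
    = four_block_mat (1\<^sub>m 1) (0\<^sub>m 1 n) (0\<^sub>m m 1) (rank_nf m n k :: 'a::semiring_1 mat)"
  by (rule eq_matI) (auto simp: rank_nf_def)

text \<open>Invertibility is expressed by nonzero determinants, which are easy to follow through
  products and block matrices. The bounds on \<open>k\<close> make it the rank of
  \<open>A\<close>.\<close>

definition has_rank_nf :: "'a::field mat \<Rightarrow> nat \<Rightarrow> nat \<Rightarrow> bool" where
  "has_rank_nf A m n \<longleftrightarrow> (\<exists>P Q k. P \<in> carrier_mat m m \<and> Q \<in> carrier_mat n n \<and>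
     det P \<noteq> 0 \<and> det Q \<noteq> 0 \<and> k \<le> m \<and> k \<le> n \<and> A = P * rank_nf m n k * Q)"

lemma has_rank_nf_mult:
  assumes B: "has_rank_nf B m n" and U: "U \<in> carrier_mat m m" "det U \<noteq> 0"
    and W: "W \<in> carrier_mat n n" "det W \<noteq> 0"
  shows "has_rank_nf (U * B * W) m n"
proof -
  obtain P Q k where *: "P \<in> carrier_mat m m" "Q \<in> carrier_mat n n" "det P \<noteq> 0" "det Q \<noteq> 0"
    "k \<le> m" "k \<le> n" "B = P * rank_nf m n k * Q" using B unfolding has_rank_nf_def by blast
  have "U * B * W = (U * P) * rank_nf m n k * (Q * W)"
    unfolding *(7) using carrier_matD[OF *(1)] carrier_matD[OF *(2)] carrier_matD[OF U(1)]
      carrier_matD[OF W(1)] by (simp add: mat_assoc)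
  thus ?thesis unfolding has_rank_nf_def
    by (intro exI[of _ "U * P"] exI[of _ "Q * W"] exI[of _ k])
       (use * U W in \<open>auto simp: det_mult[of _ m] det_mult[of _ n]\<close>)
qed

text \<open>One step of block Gaussian elimination: \<open>A = L * D * U\<close> with
  \<open>L\<close>, \<open>U\<close> invertible and \<open>D\<close> block diagonal with blocks 1
  and \<open>M\<close>. The normal form of the smaller block \<open>M\<close> extends to
  \<open>D\<close>.\<close>

lemma has_rank_nf_pivot:
  fixes A :: "'a::field mat"
  assumes A: "A \<in> carrier_mat (Suc m) (Suc n)" and pivot: "A $$ (0,0) \<noteq> 0"
    and IH: "\<And>B :: 'a mat. B \<in> carrier_mat m n \<Longrightarrow> has_rank_nf B m n"
  shows "has_rank_nf A (Suc m) (Suc n)"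
proof -
  obtain A1 A2 A3 A4 where spl: "split_block A 1 1 = (A1,A2,A3,A4)" by (metis prod_cases4)
  have blk: "A1 \<in> carrier_mat 1 1" "A2 \<in> carrier_mat 1 n" "A3 \<in> carrier_mat m 1" "A4 \<in> carrier_mat m n"
    and A4b: "A = four_block_mat A1 A2 A3 A4"
    using split_block[OF spl, of m n] A by auto
  define a where "a = A $$ (0,0)"
  have A1: "A1 = a \<cdot>\<^sub>m 1\<^sub>m 1" unfolding a_def A4b by (rule eq_matI) (use blk in auto)
  have a: "a \<noteq> 0" using pivot a_def by simp
  \<comment> \<open>This is the Schur complement of the pivot \<open>a\<close>.\<close>
  define M where "M = A4 - ((1/a) \<cdot>\<^sub>m A3) * A2"
  have M: "M \<in> carrier_mat m n" unfolding M_def carrier_mat_def using blk by auto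
  define L where "L = four_block_mat (1\<^sub>m 1) (0\<^sub>m 1 m) ((1/a) \<cdot>\<^sub>m A3) (1\<^sub>m m)"
  \<comment> \<open>The pivot goes into \<open>U\<close>, whose determinant becomes
    \<open>a\<close>, so that \<open>D\<close> starts with the entry 1 as in
    \<open>rank_nf_Suc\<close>.\<close>
  define U where "U = four_block_mat A1 A2 (0\<^sub>m n 1) (1\<^sub>m n)"
  define D where "D = four_block_mat (1\<^sub>m 1) (0\<^sub>m 1 n) (0\<^sub>m m 1) M"
  have LD: "L * D = four_block_mat (1\<^sub>m 1) (0\<^sub>m 1 n) ((1/a) \<cdot>\<^sub>m A3) M"
    unfolding L_def D_def
    by (subst mult_four_block_mat[of _ 1 1 _ m _ m _ _ 1 _ n]) (use blk M in auto)
  have "L * D * U = four_block_mat A1 A2 ((1/a) \<cdot>\<^sub>m A3 * A1) ((1/a) \<cdot>\<^sub>m A3 * A2 + M)"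
    unfolding LD U_def
    by (subst mult_four_block_mat[of _ 1 1 _ n _ m _ _ 1 _ n]) (use blk M in auto)
  also have "(1/a) \<cdot>\<^sub>m A3 * A1 = A3" unfolding A1
    using blk a by (auto simp: mult_smult_distrib[of _ m 1])
  also have "(1/a) \<cdot>\<^sub>m A3 * A2 + M = A4" unfolding M_def
    by (rule eq_matI) (use blk in auto)
  finally have LDU: "A = L * D * U" using A4b by simp
  have L: "L \<in> carrier_mat (Suc m) (Suc m)" unfolding L_def using blk by auto
  have U: "U \<in> carrier_mat (Suc n) (Suc n)" unfolding U_def using blk by auto
  have dL: "det L = 1" unfolding L_def
    by (subst det_four_block_mat_upper_right_zero[of _ 1 _ m]) (use blk in auto)
  have dU: "det U = a" unfolding U_def
    by (subst det_four_block_mat_lower_left_zero[of _ 1 _ n]) (use blk A1 in \<open>auto simp: det_single\<close>)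
  obtain P Q k where *: "P \<in> carrier_mat m m" "Q \<in> carrier_mat n n" "det P \<noteq> 0" "det Q \<noteq> 0"
    "k \<le> m" "k \<le> n" "M = P * rank_nf m n k * Q" using IH[OF M] unfolding has_rank_nf_def by blast
  define P' where "P' = four_block_mat (1\<^sub>m 1) (0\<^sub>m 1 m) (0\<^sub>m m 1) P"
  define Q' where "Q' = four_block_mat (1\<^sub>m 1) (0\<^sub>m 1 n) (0\<^sub>m n 1) Q"
  have P': "P' \<in> carrier_mat (Suc m) (Suc m)" "det P' \<noteq> 0"
    unfolding P'_def using * by (auto simp: det_four_block_mat_upper_right_zero[of _ 1 _ m])
  have Q': "Q' \<in> carrier_mat (Suc n) (Suc n)" "det Q' \<noteq> 0"
    unfolding Q'_def using * by (auto simp: det_four_block_mat_upper_right_zero[of _ 1 _ n])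
  \<comment> \<open>Bordering \<open>P\<close> and \<open>Q\<close> with a 1 adds one unit on the
    diagonal, so the index \<open>k\<close> for \<open>M\<close> turns into \<open>Suc k\<close> for
    \<open>D\<close>.\<close>
  have "P' * rank_nf (Suc m) (Suc n) (Suc k) * Q' = D"
    unfolding P'_def Q'_def rank_nf_Suc D_def *(7)
    using *(1,2)
    by (simp add: mult_four_block_mat[of _ 1 1 _ m _ m _ _ 1 _ n] left_add_zero_mat[of _ m n]
        mult_four_block_mat[of _ 1 1 _ n _ m _ _ 1 _ n] mult_carrier_mat[of _ m n _ n] mult_carrier_mat[of _ m m _ n])
  hence "has_rank_nf D (Suc m) (Suc n)" unfolding has_rank_nf_def
    using P' Q' *(5,6) by (metis Suc_le_mono)
  from has_rank_nf_mult[OF this L _ U] show ?thesis unfolding LDU using dL dU a by simp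
qed

lemma swaprows_mat_det_nonzero:
  assumes "k < n" "l < n"
  shows "det (swaprows_mat n k l :: 'a::field mat) \<noteq> 0"
proof -
  have "det (swaprows_mat n k l :: 'a mat) * det (swaprows_mat n k l :: 'a mat) = 1"
    using det_mult[of "swaprows_mat n k l :: 'a mat" n "swaprows_mat n k l"] swaprows_mat_inv[OF assms, where 'a='a]
    by simp
  thus ?thesis by auto
qed

text \<open>Induction on the number of rows. A nonzero entry of a nonzero matrix is moved to
  position (0,0) by one row swap and one column swap, after which the pivot step applies.\<close>

lemma rank_normal_form:
  fixes A :: "'a::field mat"
  assumes "A \<in> carrier_mat m n"
  shows "has_rank_nf A m n"
  using assms
proof (induction m arbitrary: n A)
  case (0 n A)
  hence "A = 1\<^sub>m 0 * rank_nf 0 n 0 * 1\<^sub>m n" by auto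
  thus ?case unfolding has_rank_nf_def
    by (intro exI[of _ "1\<^sub>m 0"] exI[of _ "1\<^sub>m n"] exI[of _ 0]) auto
next
  case (Suc m n A)
  show ?case
  proof (cases "A = 0\<^sub>m (Suc m) n")
    case True
    hence "A = 1\<^sub>m (Suc m) * rank_nf (Suc m) n 0 * 1\<^sub>m n" by (auto simp: rank_nf_def)
    thus ?thesis unfolding has_rank_nf_def
      by (intro exI[of _ "1\<^sub>m (Suc m)"] exI[of _ "1\<^sub>m n"] exI[of _ 0]) auto
  next
    case False
    then obtain i j where ij: "i < Suc m" "j < n" "A $$ (i,j) \<noteq> 0"
      using Suc.prems by (metis carrier_matD eq_matI index_zero_mat)
    then obtain n' where n: "n = Suc n'" by (cases n) auto
    let ?P = "swaprows_mat (Suc m) 0 i :: 'a mat" and ?Q = "swaprows_mat n 0 j :: 'a mat"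
    define B where "B = ?P * A * ?Q"
    have B1: "B = swapcols 0 j (swaprows 0 i A)"
      unfolding B_def using ij Suc.prems
      by (subst swaprows_mat[of A "Suc m" n, symmetric], simp_all, subst swapcols_mat[of _ "Suc m" n]) simp_all
    have "B $$ (0,0) \<noteq> 0" "B \<in> carrier_mat (Suc m) (Suc n')"
      unfolding B1 using ij Suc.prems n by (auto split: if_splits)
    hence nf: "has_rank_nf B (Suc m) n"
      using has_rank_nf_pivot[of B m n'] Suc.IH n by blast
    \<comment> \<open>Swap matrices are involutions, so the same two matrices lead back from
      \<open>B\<close> to \<open>A\<close>.\<close>
    have PP: "?P * ?P = 1\<^sub>m (Suc m)" and QQ: "?Q * ?Q = 1\<^sub>m n"
      using ij swaprows_mat_inv[of 0 "Suc m" i] swaprows_mat_inv[of 0 n j] by auto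
    have "?P * B * ?Q = (?P * ?P) * A * (?Q * ?Q)"
      unfolding B_def using carrier_matD[OF Suc.prems] by (simp add: mat_assoc)
    also have "\<dots> = A" unfolding PP QQ using Suc.prems by simp
    finally have "A = ?P * B * ?Q" ..
    thus ?thesis using has_rank_nf_mult[OF nf, of ?P ?Q] ij swaprows_mat_det_nonzero
      by (metis less_nat_zero_code not_gr_zero swaprows_mat_carrier zero_less_Suc)
  qed
qed

lemma det_nonzero_inverse:
  fixes P :: "'a::field mat"
  assumes P: "P \<in> carrier_mat n n" and "det P \<noteq> 0"
  shows "\<exists>P'. P' \<in> carrier_mat n n \<and> P * P' = 1\<^sub>m n \<and> P' * P = 1\<^sub>m n"
  using det_non_zero_imp_unit[OF assms, of "()"] unfolding Units_def ring_mat_simps by auto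

lemma rank_normal_formE:
  fixes A :: "'a::field mat"
  assumes "A \<in> carrier_mat m n"
  obtains P P' Q Q' k where "P \<in> carrier_mat m m" "P' \<in> carrier_mat m m" "P * P' = 1\<^sub>m m" "P' * P = 1\<^sub>m m"
    "Q \<in> carrier_mat n n" "Q' \<in> carrier_mat n n" "Q * Q' = 1\<^sub>m n" "Q' * Q = 1\<^sub>m n"
    "k \<le> m" "k \<le> n" "A = P * rank_nf m n k * Q"
proof -
  obtain P Q k where *: "P \<in> carrier_mat m m" "Q \<in> carrier_mat n n" "det P \<noteq> 0" "det Q \<noteq> 0"
    "k \<le> m" "k \<le> n" "A = P * rank_nf m n k * Q"
    using rank_normal_form[OF assms] unfolding has_rank_nf_def by blast
  obtain P' where "P' \<in> carrier_mat m m" "P * P' = 1\<^sub>m m" "P' * P = 1\<^sub>m m"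
    using det_nonzero_inverse[OF *(1,3)] by blast
  moreover obtain Q' where "Q' \<in> carrier_mat n n" "Q * Q' = 1\<^sub>m n" "Q' * Q = 1\<^sub>m n"
    using det_nonzero_inverse[OF *(2,4)] by blast
  ultimately show thesis using that *(1,2,5-7) by blast
qed

section \<open>Products with the normal form, and its rank\<close>

lemma rank_nf_mult_left:
  assumes "Y \<in> carrier_mat n s"
  shows "rank_nf m n k * Y = mat m s (\<lambda>(i,j). if i < k \<and> i < n then Y $$ (i,j) else (0::'a::semiring_1))"
proof (rule eq_matI)
  fix i j assume ij: "i < dim_row (mat m s (\<lambda>(i,j). if i < k \<and> i < n then Y $$ (i,j) else 0))"
    "j < dim_col (mat m s (\<lambda>(i,j). if i < k \<and> i < n then Y $$ (i,j) else 0))"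
  have "(rank_nf m n k * Y) $$ (i,j) = (\<Sum>l = 0..<n. (if i = l \<and> i < k then 1 else 0) * Y $$ (l,j))"
    using ij assms by (simp add: scalar_prod_def rank_nf_def)
  also have "\<dots> = (\<Sum>l = 0..<n. if l = i then (if i < k then Y $$ (i,j) else 0) else 0)"
    by (rule sum.cong) auto
  also have "\<dots> = (if i < k \<and> i < n then Y $$ (i,j) else 0)" by simp
  finally show "(rank_nf m n k * Y) $$ (i,j) = mat m s (\<lambda>(i,j). if i < k \<and> i < n then Y $$ (i,j) else 0) $$ (i,j)"
    using ij by simp
qed (use assms in auto)

lemma rank_nf_mult_right:
  assumes "Y \<in> carrier_mat r m"
  shows "Y * rank_nf m n k = mat r n (\<lambda>(i,j). if j < k \<and> j < m then Y $$ (i,j) else (0::'a::semiring_1))"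
proof (rule eq_matI)
  fix i j assume ij: "i < dim_row (mat r n (\<lambda>(i,j). if j < k \<and> j < m then Y $$ (i,j) else 0))"
    "j < dim_col (mat r n (\<lambda>(i,j). if j < k \<and> j < m then Y $$ (i,j) else 0))"
  have "(Y * rank_nf m n k) $$ (i,j) = (\<Sum>l = 0..<m. Y $$ (i,l) * (if l = j \<and> l < k then 1 else 0))"
    using ij assms by (simp add: scalar_prod_def rank_nf_def)
  also have "\<dots> = (\<Sum>l = 0..<m. if l = j then (if j < k then Y $$ (i,j) else 0) else 0)"
    by (rule sum.cong) auto
  also have "\<dots> = (if j < k \<and> j < m then Y $$ (i,j) else 0)" by simp
  finally show "(Y * rank_nf m n k) $$ (i,j) = mat r n (\<lambda>(i,j). if j < k \<and> j < m then Y $$ (i,j) else 0) $$ (i,j)"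
    using ij by simp
qed (use assms in auto)

lemma rank_nf_mult_vec:
  assumes "v \<in> carrier_vec n"
  shows "rank_nf m n k *\<^sub>v v = vec m (\<lambda>i. if i < k \<and> i < n then v $ i else (0::'a::semiring_1))"
proof (rule eq_vecI)
  fix i assume i: "i < dim_vec (vec m (\<lambda>i. if i < k \<and> i < n then v $ i else 0))"
  have "(rank_nf m n k *\<^sub>v v) $ i = (\<Sum>l = 0..<n. (if i = l \<and> i < k then 1 else 0) * v $ l)"
    using i assms by (simp add: scalar_prod_def rank_nf_def)
  also have "\<dots> = (\<Sum>l = 0..<n. if l = i then (if i < k then v $ i else 0) else 0)"
    by (rule sum.cong) auto
  also have "\<dots> = (if i < k \<and> i < n then v $ i else 0)" by simp
  finally show "(rank_nf m n k *\<^sub>v v) $ i = vec m (\<lambda>i. if i < k \<and> i < n then v $ i else 0) $ i"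
    using i by simp
qed (use assms in auto)

text \<open>Multiplication by \<open>P'\<close> identifies the column space with the vectors
  supported on the first \<open>k\<close> coordinates. Those coordinates bound its dimension from
  above and, read backwards through \<open>P\<close>, from below.\<close>

lemma rank_eq_rank_nf:
  fixes P Q :: "'a::field mat"
  assumes P: "P \<in> carrier_mat m m" "P' \<in> carrier_mat m m" "P * P' = 1\<^sub>m m" "P' * P = 1\<^sub>m m"
    and Q: "Q \<in> carrier_mat n n" "Q' \<in> carrier_mat n n" "Q * Q' = 1\<^sub>m n"
    and k: "k \<le> m" "k \<le> n"
  shows "vec_space.rank m (P * rank_nf m n k * Q) = k"
proof -
  interpret vec_space "TYPE('a)" m .
  let ?A = "P * rank_nf m n k * Q"
  have A: "?A \<in> carrier_mat m n" using P Q by auto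
  let ?W = "V\<lparr>carrier := col_space ?A\<rparr>"
  have "set (cols ?A) \<subseteq> carrier_vec m" using cols_dim[of ?A] P(1) by simp
  hence vs: "vectorspace class_ring ?W"
    unfolding col_space_def by (intro subspace_is_vs span_is_subspace) simp
  have carr: "carrier ?W = {y \<in> carrier_vec m. \<exists>x\<in>carrier_vec n. ?A *\<^sub>v x = y}"
    using col_space_eq[OF A] P(1) Q(1) by simp
  have Ax: "P' *\<^sub>v (?A *\<^sub>v x) = vec m (\<lambda>i. if i < k then (Q *\<^sub>v x) $ i else 0)"
    if x: "x \<in> carrier_vec n" for x
  proof -
    have Qx: "Q *\<^sub>v x \<in> carrier_vec n" using mult_mat_vec_carrier[OF Q(1) x] .
    have DQx: "rank_nf m n k *\<^sub>v (Q *\<^sub>v x) \<in> carrier_vec m"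
      using mult_mat_vec_carrier[OF rank_nf_carrier(1) Qx] .
    have "P' *\<^sub>v (?A *\<^sub>v x) = P' *\<^sub>v (P *\<^sub>v (rank_nf m n k *\<^sub>v (Q *\<^sub>v x)))"
      using P Q x by (simp add: assoc_mult_mat_vec[of _ m n _ n] assoc_mult_mat_vec[of _ m m _ n]
          mult_mat_vec_carrier[of _ n n])
    also have "\<dots> = (P' * P) *\<^sub>v (rank_nf m n k *\<^sub>v (Q *\<^sub>v x))"
      by (rule assoc_mult_mat_vec[symmetric, OF P(2,1) DQx])
    also have "\<dots> = rank_nf m n k *\<^sub>v (Q *\<^sub>v x)"
      unfolding P(4) by (rule one_mult_mat_vec[OF DQx])
    also have "\<dots> = vec m (\<lambda>i. if i < k then (Q *\<^sub>v x) $ i else 0)"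
      unfolding rank_nf_mult_vec[OF Qx] using k by (auto intro!: eq_vecI)
    finally show ?thesis .
  qed
  have PP: "P *\<^sub>v (P' *\<^sub>v y) = y" if "y \<in> carrier_vec m" for y
    using assoc_mult_mat_vec[OF P(1,2) that, symmetric] P(3) that by simp
  have PP': "P' *\<^sub>v (P *\<^sub>v y) = y" if "y \<in> carrier_vec m" for y
    using assoc_mult_mat_vec[OF P(2,1) that, symmetric] P(4) that by simp
  note * = vectorspace_dim_le_coords[OF vs, of "{..<k}" "\<lambda>y i. (P' *\<^sub>v y) $ i", unfolded carr]
  have inj: "y = 0\<^sub>v m" if y: "y \<in> {y \<in> carrier_vec m. \<exists>x\<in>carrier_vec n. ?A *\<^sub>v x = y}"
    and z: "\<And>i. i \<in> {..<k} \<Longrightarrow> (P' *\<^sub>v y) $ i = 0" for y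
  proof -
    obtain x where x: "x \<in> carrier_vec n" "y = ?A *\<^sub>v x" using y by auto
    have "P' *\<^sub>v y = 0\<^sub>v m"
    proof (rule eq_vecI)
      fix i assume "i < dim_vec (0\<^sub>v m)"
      thus "(P' *\<^sub>v y) $ i = 0\<^sub>v m $ i"
        using z[of i] Ax[OF x(1)] x(2) by (cases "i < k") auto
    qed (use P in auto)
    thus ?thesis using PP[of y] y P by auto
  qed
  have lin: "(P' *\<^sub>v (x + y)) $ i = (P' *\<^sub>v x) $ i + (P' *\<^sub>v y) $ i"
    "(P' *\<^sub>v (c \<cdot>\<^sub>v x)) $ i = c * (P' *\<^sub>v x) $ i"
    if "x \<in> carrier_vec m" "y \<in> carrier_vec m" "i < k" for x y c i
    using that P(2) k by (simp_all add: mult_add_distrib_mat_vec[of _ m m] mult_mat_vec[of _ m m])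
  have fd: "vectorspace.fin_dim class_ring ?W"
    by (rule *(1)) (use inj lin in \<open>auto simp: module_vec_simps\<close>)
  have le: "vectorspace.dim class_ring ?W \<le> card {..<k}"
    by (rule *(2)) (use inj lin in \<open>auto simp: module_vec_simps\<close>)
  \<comment> \<open>The same \<open>k\<close> parameters are needed in two lengths: \<open>n\<close>
    in the domain of the matrix and \<open>m\<close> in its codomain. Both hold them because
    \<open>k\<close> is at most \<open>m\<close> and \<open>n\<close>.\<close>
  define u :: "(nat \<Rightarrow> 'a) \<Rightarrow> nat \<Rightarrow> 'a vec" where "u = (\<lambda>c l. vec l (\<lambda>i. if i < k then c i else 0))"
  have u: "u c l \<in> carrier_vec l" for c l by (simp add: u_def)
  have Pu: "P *\<^sub>v u c m \<in> carrier ?W" for c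
  proof -
    \<comment> \<open>The witness \<open>Q' *\<^sub>v u c n\<close> is chosen so that
      \<open>Q\<close> cancels and the normal form only changes the length of the padding.\<close>
    have "?A *\<^sub>v (Q' *\<^sub>v u c n) = P *\<^sub>v (P' *\<^sub>v (?A *\<^sub>v (Q' *\<^sub>v u c n)))"
      using PP[of "?A *\<^sub>v (Q' *\<^sub>v u c n)"] P A Q u by (auto intro: mult_mat_vec_carrier)
    also have "P' *\<^sub>v (?A *\<^sub>v (Q' *\<^sub>v u c n)) = vec m (\<lambda>i. if i < k then (Q *\<^sub>v (Q' *\<^sub>v u c n)) $ i else 0)"
      by (rule Ax) (use Q u in auto)
    also have "Q *\<^sub>v (Q' *\<^sub>v u c n) = u c n"
      using assoc_mult_mat_vec[OF Q(1,2) u, symmetric] Q(3) u by simp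
    also have "vec m (\<lambda>i. if i < k then u c n $ i else 0) = u c m"
      using k by (auto simp: u_def intro!: eq_vecI)
    finally have "?A *\<^sub>v (Q' *\<^sub>v u c n) = P *\<^sub>v u c m" .
    thus ?thesis unfolding carr using P Q u by (auto intro!: bexI[of _ "Q' *\<^sub>v u c n"])
  qed
  have "card {..<k} \<le> vectorspace.dim class_ring ?W"
  proof (rule vectorspace_dim_ge_coords[OF vs, of _ "\<lambda>c. P *\<^sub>v u c m"])
    show "vectorspace.fin_dim class_ring ?W" by (rule fd)
    show "P *\<^sub>v u c m \<in> carrier ?W" for c by (rule Pu)
    show "P *\<^sub>v u (\<lambda>i. c i + d i) m = P *\<^sub>v u c m \<oplus>\<^bsub>?W\<^esub> P *\<^sub>v u d m" for c d
    proof -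
      have "u (\<lambda>i. c i + d i) m = u c m + u d m" by (auto simp: u_def intro!: eq_vecI)
      thus ?thesis using mult_add_distrib_mat_vec[OF P(1) u u] by (simp add: module_vec_simps)
    qed
    show "P *\<^sub>v u (\<lambda>i. a * c i) m = a \<odot>\<^bsub>?W\<^esub> (P *\<^sub>v u c m)" for a c
    proof -
      have "u (\<lambda>i. a * c i) m = a \<cdot>\<^sub>v u c m" by (auto simp: u_def intro!: eq_vecI)
      thus ?thesis using mult_mat_vec[OF P(1) u] by (simp add: module_vec_simps)
    qed
    fix c i assume z: "P *\<^sub>v u c m = \<zero>\<^bsub>?W\<^esub>" and i: "i \<in> {..<k}"
    have "P' *\<^sub>v 0\<^sub>v m = 0\<^sub>v m" using P(2) by (intro eq_vecI) (auto simp: scalar_prod_def)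
    hence "u c m = 0\<^sub>v m" using PP'[OF u, of c] z by (simp add: module_vec_simps)
    hence "u c m $ i = 0" using i k by auto
    thus "c i = 0" using i k by (auto simp: u_def)
  qed simp
  thus ?thesis using le unfolding rank_def col_space_def by auto
qed

section \<open>The rank bounds\<close>

text \<open>Once \<open>mat_assoc\<close> has nested products to the right, \<open>P * P'\<close> no
  longer occurs as a subterm; this form cancels the pair in front of a remaining factor.\<close>

lemma mult_cancel_left_inverse:
  assumes "P * P' = 1\<^sub>m n" "P' \<in> carrier_mat n n" "dim_row Y = n" "P \<in> carrier_mat n n"
  shows "P * (P' * Y) = (Y :: 'a::semiring_1 mat)"
proof -
  have "P * (P' * Y) = (P * P') * Y" by (rule mat_assoc[symmetric]) (use assms in auto)
  also have "\<dots> = Y" unfolding assms(1) by (rule left_mult_one_mat) (use assms in auto)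
  finally show ?thesis .
qed

lemma mat_mult_zero[simp]:
  "dim_col Y = m \<Longrightarrow> Y * 0\<^sub>m m n = 0\<^sub>m (dim_row Y) n"
  "dim_row Y = m \<Longrightarrow> 0\<^sub>m n m * Y = (0\<^sub>m n (dim_col Y) :: 'a::semiring_0 mat)"
  by (auto intro: right_mult_zero_mat left_mult_zero_mat)

text \<open>Supplies the linearity of the coordinate maps and parametrisations of C(A,B) below,
  which have the shape \<open>P * Y * R\<close>.\<close>

lemma sandwich_linear:
  fixes P :: "'a::comm_semiring_1 mat"
  assumes "P \<in> carrier_mat m r" "R \<in> carrier_mat s n" "Y \<in> carrier_mat r s" "Z \<in> carrier_mat r s"
  shows "P * (Y + Z) * R = P * Y * R + P * Z * R" "P * (c \<cdot>\<^sub>m Y) * R = c \<cdot>\<^sub>m (P * Y * R)"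
proof -
  have PY: "P * Y \<in> carrier_mat m s" "P * Z \<in> carrier_mat m s" using assms by auto
  show "P * (Y + Z) * R = P * Y * R + P * Z * R"
    using mult_add_distrib_mat[OF assms(1,3,4)] add_mult_distrib_mat[OF PY assms(2)] by simp
  show "P * (c \<cdot>\<^sub>m Y) * R = c \<cdot>\<^sub>m (P * Y * R)"
    using mult_smult_distrib[OF assms(1,3)] mult_smult_assoc_mat[OF PY(1) assms(2)] by simp
qed

lemma dim_C_rank_bounds:
  fixes A B :: "'a::field mat"
  assumes A: "A \<in> carrier_mat r r" and B: "B \<in> carrier_mat s s"
  shows "(r - Rk A) * (s - Rk B) \<le> dim_C A B"
    and "dim_C A B \<le> (r - Rk A) * (s - Rk B) + Rk A * Rk B"
proof -
  obtain P P' Q Q' a where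
    P: "P \<in> carrier_mat r r" "P' \<in> carrier_mat r r" "P * P' = 1\<^sub>m r" "P' * P = 1\<^sub>m r"
    and Q: "Q \<in> carrier_mat r r" "Q' \<in> carrier_mat r r" "Q * Q' = 1\<^sub>m r" "Q' * Q = 1\<^sub>m r"
    and a: "a \<le> r" "a \<le> r" and Aeq: "A = P * rank_nf r r a * Q"
    by (rule rank_normal_formE[OF A])
  obtain R R' S S' b where
    R: "R \<in> carrier_mat s s" "R' \<in> carrier_mat s s" "R * R' = 1\<^sub>m s" "R' * R = 1\<^sub>m s"
    and S: "S \<in> carrier_mat s s" "S' \<in> carrier_mat s s" "S * S' = 1\<^sub>m s" "S' * S = 1\<^sub>m s"
    and b: "b \<le> s" "b \<le> s" and Beq: "B = R * rank_nf s s b * S"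
    by (rule rank_normal_formE[OF B])
  have ra: "Rk A = a" unfolding Rk_def carrier_matD(1)[OF A] unfolding Aeq by (rule rank_eq_rank_nf[OF P Q(1-3) a])
  have rb: "Rk B = b" unfolding Rk_def carrier_matD(1)[OF B] unfolding Beq by (rule rank_eq_rank_nf[OF R S(1-3) b])
  note d = carrier_matD[OF P(1)] carrier_matD[OF P(2)] carrier_matD[OF Q(1)] carrier_matD[OF Q(2)]
    carrier_matD[OF R(1)] carrier_matD[OF R(2)] carrier_matD[OF S(1)] carrier_matD[OF S(2)]
  note canc = mult_cancel_left_inverse[OF P(3,2) _ P(1)] mult_cancel_left_inverse[OF P(4,1) _ P(2)]
    mult_cancel_left_inverse[OF Q(3,2) _ Q(1)] mult_cancel_left_inverse[OF Q(4,1) _ Q(2)]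
    mult_cancel_left_inverse[OF R(3,2) _ R(1)] mult_cancel_left_inverse[OF R(4,1) _ R(2)]
    mult_cancel_left_inverse[OF S(3,2) _ S(1)] mult_cancel_left_inverse[OF S(4,1) _ S(2)]
  \<comment> \<open>These matrices fill the lower right corner, which is annihilated by the normal
    form of \<open>A\<close> from the left and by that of \<open>B\<close> from the right.\<close>
  define E where "E = (\<lambda>c. mat r s (\<lambda>(i,j). if a \<le> i \<and> b \<le> j then c (i,j) else (0::'a)))"
  have E: "E c \<in> carrier_mat r s" for c by (simp add: E_def)
  note dE = carrier_matD[OF E]
  have zE: "rank_nf r r a * E c = 0\<^sub>m r s" for c
    unfolding rank_nf_mult_left[OF E] by (rule eq_matI) (simp_all add: E_def)
  have zE': "E c * rank_nf s s b = 0\<^sub>m r s" for c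
    unfolding rank_nf_mult_right[OF E] by (rule eq_matI) (simp_all add: E_def)
  have "card ({a..<r} \<times> {b..<s}) \<le> dim_C A B"
  proof (rule dim_C_ge[OF A B, of _ "\<lambda>c. Q' * E c * R'"])
    show "Q' * E c * R' \<in> carrier_mat r s" for c using mult_carrier_mat[OF mult_carrier_mat[OF Q(2) E] R(2)] .
    show "A * (Q' * E c * R') = Q' * E c * R' * B" for c
    proof -
      \<comment> \<open>Both sides of the commutation equation are 0: after cancelling
        \<open>Q\<close> with \<open>Q'\<close>, and later \<open>R'\<close> with \<open>R\<close>,
        a normal form meets \<open>E c\<close>.\<close>
      have "A * (Q' * E c * R') = P * (rank_nf r r a * E c) * R'"
        unfolding Aeq by (simp add: mat_assoc d dE canc)
      also have "\<dots> = Q' * (E c * rank_nf s s b) * S" unfolding zE zE' by (simp add: d)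
      also have "\<dots> = Q' * E c * R' * B"
        unfolding Beq by (simp add: mat_assoc d dE canc)
      finally show ?thesis .
    qed
    show "Q' * E (\<lambda>i. c i + e i) * R' = Q' * E c * R' + Q' * E e * R'" for c e
    proof -
      have "E (\<lambda>i. c i + e i) = E c + E e" by (auto simp: E_def intro!: eq_matI)
      thus ?thesis using sandwich_linear(1)[OF Q(2) R(2) E E] by simp
    qed
    show "Q' * E (\<lambda>i. k * c i) * R' = k \<cdot>\<^sub>m (Q' * E c * R')" for k c
    proof -
      have "E (\<lambda>i. k * c i) = k \<cdot>\<^sub>m E c" by (auto simp: E_def intro!: eq_matI)
      thus ?thesis using sandwich_linear(2)[OF Q(2) R(2) E E] by simp
    qed
    fix c ij assume z: "Q' * E c * R' = 0\<^sub>m r s" and ij: "ij \<in> {a..<r} \<times> {b..<s}"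
    have "E c = Q * (Q' * E c * R') * R" using R(4) E[of c] by (simp add: mat_assoc d dE canc)
    also have "\<dots> = 0\<^sub>m r s" unfolding z by (simp add: d)
    finally have "E c $$ ij = 0" using ij by auto
    thus "c ij = 0" using ij by (auto simp: E_def)
  qed simp
  thus "(r - Rk A) * (s - Rk B) \<le> dim_C A B" unfolding ra rb by simp
  let ?T = "({..<a} \<times> {..<b}) \<union> ({a..<r} \<times> {b..<s})"
  \<comment> \<open>On \<open>?T\<close> the test \<open>i < a\<close> separates the two kinds of
    coordinates: the upper left block is read off from \<open>P' * A * Y * S'\<close>, the lower
    right corner from \<open>Q * Y * R\<close>.\<close>
  define f where "f = (\<lambda>Y (i,j). if i < a then (P' * A * Y * S') $$ (i,j) else (Q * Y * R) $$ (i,j))"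
  have dA: "dim_row A = r" "dim_col A = r" "dim_row B = s" "dim_col B = s" using A B by auto
  have PA: "P' * A \<in> carrier_mat r r" using P(2) A by simp
  have "dim_C A B \<le> card ?T"
  proof (rule dim_C_le(2)[OF A B, of _ f])
    show "finite ?T" by simp
    fix Y Z :: "'a mat" and c p assume Y: "Y \<in> carrier_mat r s" and p: "p \<in> ?T"
    obtain i j where pij: "p = (i,j)" by force
    have ij: "i < r" "j < s" using p pij a b by auto
    show "f (Y + Z) p = f Y p + f Z p" if "Z \<in> carrier_mat r s"
      unfolding f_def pij prod.case sandwich_linear(1)[OF PA S(2) Y that] sandwich_linear(1)[OF Q(1) R(1) Y that]
      using ij by (simp add: d)
    show "f (c \<cdot>\<^sub>m Y) p = c * f Y p"
      unfolding f_def pij prod.case sandwich_linear(2)[OF PA S(2) Y Y] sandwich_linear(2)[OF Q(1) R(1) Y Y]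
      using ij by (simp add: d)
  next
    fix Y assume Y: "Y \<in> carrier_mat r s" and comm: "A * Y = Y * B"
      and z: "\<And>p. p \<in> ?T \<Longrightarrow> f Y p = 0"
    note dY = carrier_matD[OF Y]
    define W where "W = P' * A * Y * S'"
    \<comment> \<open>The first form shows that only the first \<open>a\<close> rows of
      \<open>W\<close> can be nonzero. The second, obtained from \<open>A * Y = Y * B\<close>, shows
      the same for the first \<open>b\<close> columns. What is left is the block controlled by
      \<open>f\<close>.\<close>
    have W1: "W = rank_nf r r a * (Q * Y * S')" unfolding W_def Aeq by (simp add: mat_assoc d dY canc)
    have W2: "W = (P' * Y * R) * rank_nf s s b"
    proof -
      have "W = P' * (A * Y) * S'" unfolding W_def by (simp add: mat_assoc d dA dY)
      thus ?thesis unfolding comm Beq using S(3) by (simp add: mat_assoc d dY canc)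
    qed
    have W0: "W = 0\<^sub>m r s"
    proof (rule eq_matI)
      fix i j assume ij: "i < dim_row (0\<^sub>m r s :: 'a mat)" "j < dim_col (0\<^sub>m r s :: 'a mat)"
      have "W $$ (i,j) = 0" if "a \<le> i"
        unfolding W1 using that ij d dY by (subst rank_nf_mult_left[of _ r s]) auto
      moreover have "W $$ (i,j) = 0" if "b \<le> j"
        unfolding W2 using that ij d dY by (subst rank_nf_mult_right[of _ r s]) auto
      moreover have "W $$ (i,j) = 0" if "i < a" "j < b"
        using z[of "(i,j)"] that by (simp add: f_def W_def)
      ultimately show "W $$ (i,j) = 0\<^sub>m r s $$ (i,j)" using ij by (cases "a \<le> i"; cases "b \<le> j") auto
    qed (simp_all add: W_def d dA)
    define U where "U = Q * Y * R"
    have U: "U \<in> carrier_mat r s" unfolding U_def using d by auto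
    \<comment> \<open>With \<open>W\<close> zero, both \<open>A * Y\<close> and \<open>Y * B\<close>
      vanish. In terms of \<open>U\<close> this clears the first \<open>a\<close> rows and the first
      \<open>b\<close> columns; the remaining corner is cleared by \<open>f\<close>.\<close>
    have "rank_nf r r a * U = W * S * R"
      unfolding W1 U_def by (simp add: mat_assoc d dY canc)
    hence U1: "rank_nf r r a * U = 0\<^sub>m r s" unfolding W0 by (simp add: d)
    have "U * rank_nf s s b = Q * P * W"
      unfolding W2 U_def by (simp add: mat_assoc d dY canc)
    hence U2: "U * rank_nf s s b = 0\<^sub>m r s" unfolding W0 by (simp add: d)
    have "U = 0\<^sub>m r s"
    proof (rule eq_matI)
      fix i j assume ij: "i < dim_row (0\<^sub>m r s :: 'a mat)" "j < dim_col (0\<^sub>m r s :: 'a mat)"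
      have "U $$ (i,j) = 0" if "i < a"
        using arg_cong[OF U1[unfolded rank_nf_mult_left[OF U]], of "\<lambda>M. M $$ (i,j)"] ij that by simp
      moreover have "U $$ (i,j) = 0" if "j < b"
        using arg_cong[OF U2[unfolded rank_nf_mult_right[OF U]], of "\<lambda>M. M $$ (i,j)"] ij that by simp
      moreover have "U $$ (i,j) = 0" if "a \<le> i" "b \<le> j"
        using z[of "(i,j)"] that ij by (simp add: f_def U_def)
      ultimately show "U $$ (i,j) = 0\<^sub>m r s $$ (i,j)" using ij by (cases "a \<le> i"; cases "b \<le> j") auto
    qed (use U in auto)
    moreover have "Y = Q' * U * R'" unfolding U_def using R(3) Y by (simp add: mat_assoc d dY canc)
    ultimately show "Y = 0\<^sub>m r s" by (simp add: d)
  qed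
  also have "card ?T = a * b + (r - a) * (s - b)"
    by (subst card_Un_disjoint) (auto simp: card_cartesian_product)
  finally show "dim_C A B \<le> (r - Rk A) * (s - Rk B) + Rk A * Rk B" unfolding ra rb by simp
qed

section \<open>Field extension\<close>

text \<open>Row-major numbering: the range below \<open>r * s\<close> is cut into \<open>r\<close>
  consecutive intervals of length \<open>s\<close>, on each of which \<open>q div s\<close> is
  constant.\<close>

lemma sum_div_mod:
  fixes f :: "nat \<Rightarrow> nat \<Rightarrow> 'a::comm_monoid_add"
  shows "(\<Sum>q<r * s. f (q div s) (q mod s)) = (\<Sum>k<r. \<Sum>l<s. f k l)"
proof -
  have "(\<Sum>q<r * s. f (q div s) (q mod s)) = (\<Sum>k<r. \<Sum>q\<in>{k*s..<k*s+s}. f (q div s) (q mod s))"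
    by (rule sum.nat_group[symmetric])
  also have "\<dots> = (\<Sum>k<r. \<Sum>l<s. f k l)"
  proof (rule sum.cong[OF refl])
    fix k
    have "(\<Sum>q\<in>{k*s..<k*s+s}. f (q div s) (q mod s)) = (\<Sum>l\<in>{0..<s}. f ((l + k*s) div s) ((l + k*s) mod s))"
      using sum.shift_bounds_nat_ivl[of "\<lambda>q. f (q div s) (q mod s)" 0 "k*s" s] by (simp add: add.commute)
    also have "\<dots> = (\<Sum>l<s. f k l)" by (rule sum.cong) auto
    finally show "(\<Sum>q\<in>{k*s..<k*s+s}. f (q div s) (q mod s)) = (\<Sum>l<s. f k l)" .
  qed
  finally show ?thesis .
qed

section \<open>The equation A Y = Y B as a linear system\<close>

definition vec_of_mat :: "nat \<Rightarrow> nat \<Rightarrow> 'a mat \<Rightarrow> 'a vec" where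
  "vec_of_mat r s Y = vec (r * s) (\<lambda>p. Y $$ (p div s, p mod s))"

definition mat_of_vec :: "nat \<Rightarrow> nat \<Rightarrow> 'a vec \<Rightarrow> 'a mat" where
  "mat_of_vec r s v = mat r s (\<lambda>(i,j). v $ (i * s + j))"

text \<open>The matrix of \<open>Y \<mapsto> A Y - Y B\<close> in the row-major coordinates \<open>vec_of_mat\<close>.\<close>

definition commutation_mat :: "nat \<Rightarrow> nat \<Rightarrow> 'a::ring_1 mat \<Rightarrow> 'a mat \<Rightarrow> 'a mat" where
  "commutation_mat r s A B = mat (r * s) (r * s) (\<lambda>(p,q).
     (if q mod s = p mod s then A $$ (p div s, q div s) else 0) -
     (if q div s = p div s then B $$ (q mod s, p mod s) else 0))"

lemma vec_of_mat_carrier[simp]: "vec_of_mat r s Y \<in> carrier_vec (r * s)"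
  by (simp add: vec_of_mat_def)

lemma commutation_mat_carrier[simp]: "commutation_mat r s A B \<in> carrier_mat (r * s) (r * s)"
  by (simp add: commutation_mat_def)

lemma mat_of_vec_carrier[simp]: "mat_of_vec r s v \<in> carrier_mat r s"
  by (simp add: mat_of_vec_def)

lemma div_mod_bounds: "p < r * s \<Longrightarrow> p div s < r \<and> p mod s < s" for p r s :: nat
  by (metis less_mult_imp_div_less mod_less_divisor mult_0_right neq0_conv not_less0)

lemma pair_bound: "i < r \<Longrightarrow> j < s \<Longrightarrow> i * s + j < r * s" for i j r s :: nat
proof -
  assume "i < r" "j < s"
  hence "i * s + j < Suc i * s" by simp
  also have "\<dots> \<le> r * s" using \<open>i < r\<close> by (intro mult_le_mono1) simp
  finally show ?thesis .
qed

lemma vec_of_mat_of_vec: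
  assumes "v \<in> carrier_vec (r * s)"
  shows "vec_of_mat r s (mat_of_vec r s v) = v"
  by (rule eq_vecI) (use assms in \<open>auto simp: vec_of_mat_def mat_of_vec_def div_mod_bounds\<close>)

lemma vec_of_mat_eq_iff:
  assumes "Y \<in> carrier_mat r s" "Z \<in> carrier_mat r s"
  shows "vec_of_mat r s Y = vec_of_mat r s Z \<longleftrightarrow> Y = Z"
proof
  assume eq: "vec_of_mat r s Y = vec_of_mat r s Z"
  show "Y = Z"
  proof (rule eq_matI)
    fix i j assume "i < dim_row Z" "j < dim_col Z"
    hence ij: "i < r" "j < s" using assms by auto
    show "Y $$ (i,j) = Z $$ (i,j)"
      using arg_cong[OF eq, of "\<lambda>v. v $ (i * s + j)"] pair_bound[OF ij] ij by (simp add: vec_of_mat_def)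
  qed (use assms in auto)
qed simp

lemma commutation_mat_mult_vec:
  fixes A B :: "'a::comm_ring_1 mat"
  assumes A: "A \<in> carrier_mat r r" and B: "B \<in> carrier_mat s s" and Y: "Y \<in> carrier_mat r s"
  shows "commutation_mat r s A B *\<^sub>v vec_of_mat r s Y = vec_of_mat r s (A * Y - Y * B)"
proof (rule eq_vecI)
  fix p assume "p < dim_vec (vec_of_mat r s (A * Y - Y * B))"
  hence p: "p < r * s" by (simp add: vec_of_mat_def)
  define i j where "i = p div s" and "j = p mod s"
  have ij: "i < r" "j < s" using div_mod_bounds[OF p] by (auto simp: i_def j_def)
  have "(commutation_mat r s A B *\<^sub>v vec_of_mat r s Y) $ p =
    (\<Sum>q<r * s. ((if q mod s = j then A $$ (i, q div s) else 0) -
        (if q div s = i then B $$ (q mod s, j) else 0)) * Y $$ (q div s, q mod s))"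
    unfolding i_def j_def using p
    by (simp add: scalar_prod_def commutation_mat_def vec_of_mat_def atLeast0LessThan)
  \<comment> \<open>With the flat index split into a row \<open>k\<close> and a column
    \<open>l\<close>, each of the two conditions collapses one of the two sums.\<close>
  also have "\<dots> = (\<Sum>k<r. \<Sum>l<s. ((if l = j then A $$ (i, k) else 0) -
        (if k = i then B $$ (l, j) else 0)) * Y $$ (k, l))"
    by (rule sum_div_mod)
  also have "\<dots> = (\<Sum>k<r. \<Sum>l<s. (if l = j then A $$ (i, k) * Y $$ (k, j) else 0) -
        (if k = i then Y $$ (i, l) * B $$ (l, j) else 0))"
    by (intro sum.cong refl) (auto simp: algebra_simps)
  also have "\<dots> = (\<Sum>k<r. \<Sum>l<s. if l = j then A $$ (i, k) * Y $$ (k, j) else 0) -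
      (\<Sum>k<r. \<Sum>l<s. if k = i then Y $$ (i, l) * B $$ (l, j) else 0)"
    by (simp only: sum_subtractf)
  also have "(\<Sum>k<r. \<Sum>l<s. if l = j then A $$ (i, k) * Y $$ (k, j) else 0) = (\<Sum>k<r. A $$ (i, k) * Y $$ (k, j))"
    using ij by simp
  also have "(\<Sum>k<r. \<Sum>l<s. if k = i then Y $$ (i, l) * B $$ (l, j) else 0) = (\<Sum>l<s. Y $$ (i, l) * B $$ (l, j))"
    using ij by (subst sum.swap) simp
  also have "(\<Sum>k<r. A $$ (i, k) * Y $$ (k, j)) - (\<Sum>l<s. Y $$ (i, l) * B $$ (l, j)) = (A * Y - Y * B) $$ (i,j)"
    using A B Y ij by (simp add: scalar_prod_def atLeast0LessThan)
  finally show "(commutation_mat r s A B *\<^sub>v vec_of_mat r s Y) $ p = vec_of_mat r s (A * Y - Y * B) $ p"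
    using p by (simp add: vec_of_mat_def i_def j_def)
qed (simp add: vec_of_mat_def commutation_mat_def)

lemma commutation_mat_kernel_iff:
  fixes A B :: "'a::comm_ring_1 mat"
  assumes A: "A \<in> carrier_mat r r" and B: "B \<in> carrier_mat s s" and Y: "Y \<in> carrier_mat r s"
  shows "commutation_mat r s A B *\<^sub>v vec_of_mat r s Y = 0\<^sub>v (r * s) \<longleftrightarrow> A * Y = Y * B"
proof -
  have c: "A * Y \<in> carrier_mat r s" "Y * B \<in> carrier_mat r s" using A B Y by auto
  have z: "vec_of_mat r s (0\<^sub>m r s :: 'a mat) = 0\<^sub>v (r * s)"
    by (rule eq_vecI) (auto simp: vec_of_mat_def div_mod_bounds)
  have "commutation_mat r s A B *\<^sub>v vec_of_mat r s Y = 0\<^sub>v (r * s) \<longleftrightarrow> A * Y - Y * B = 0\<^sub>m r s"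
    unfolding commutation_mat_mult_vec[OF A B Y] z[symmetric] using c
    by (intro vec_of_mat_eq_iff) (auto intro: minus_carrier_mat)
  also have "\<dots> \<longleftrightarrow> A * Y = Y * B"
  proof
    assume eq: "A * Y - Y * B = 0\<^sub>m r s"
    show "A * Y = Y * B"
    proof (rule eq_matI)
      fix i j assume "i < dim_row (Y * B)" "j < dim_col (Y * B)"
      hence "i < r" "j < s" using c by auto
      thus "(A * Y) $$ (i,j) = (Y * B) $$ (i,j)"
        using arg_cong[OF eq, of "\<lambda>M. M $$ (i,j)"] carrier_matD[OF c(1)] carrier_matD[OF c(2)]
        by (simp del: index_mult_mat)
    qed (use A B Y in auto)
  qed (use c in auto)
  finally show ?thesis .
qed

text \<open>The injective factor \<open>P\<close> drops out of the kernel condition, which then says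
  that the first \<open>k\<close> entries of \<open>Q *\<^sub>v vec_of_mat r s Y\<close> vanish. The
  other entries are free coordinates. The answer involves only \<open>k\<close>, so it can be
  compared between two fields.\<close>

lemma dim_C_eq_corank:
  fixes A B :: "'a::field mat"
  assumes A: "A \<in> carrier_mat r r" and B: "B \<in> carrier_mat s s"
    and P: "P \<in> carrier_mat (r * s) (r * s)" "P' \<in> carrier_mat (r * s) (r * s)" "P' * P = 1\<^sub>m (r * s)"
    and Q: "Q \<in> carrier_mat (r * s) (r * s)" "Q' \<in> carrier_mat (r * s) (r * s)"
      "Q * Q' = 1\<^sub>m (r * s)" "Q' * Q = 1\<^sub>m (r * s)"
    and nf: "commutation_mat r s A B = P * rank_nf (r * s) (r * s) k * Q"
  shows "dim_C A B = r * s - k"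
proof -
  define N where "N = r * s"
  note PQ = P[folded N_def] Q[folded N_def]
  have inv: "M' *\<^sub>v (M *\<^sub>v v) = v"
    if "M \<in> carrier_mat N N" "M' \<in> carrier_mat N N" "M' * M = 1\<^sub>m N" "v \<in> carrier_vec N" for M M' :: "'a mat" and v
    using assoc_mult_mat_vec[OF that(2,1,4)] that(3,4) by simp
  have mult0: "M *\<^sub>v 0\<^sub>v N = 0\<^sub>v N" if "M \<in> carrier_mat N N" for M :: "'a mat"
    using that by (intro eq_vecI) (auto simp: scalar_prod_def)
  have in_C: "A * Y = Y * B \<longleftrightarrow> (\<forall>i<N. i < k \<longrightarrow> (Q *\<^sub>v vec_of_mat r s Y) $ i = 0)"
    if Y: "Y \<in> carrier_mat r s" for Y
  proof -
    let ?w = "Q *\<^sub>v vec_of_mat r s Y"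
    let ?D = "rank_nf N N k :: 'a mat"
    have v: "vec_of_mat r s Y \<in> carrier_vec N" by (simp add: N_def)
    have w: "?w \<in> carrier_vec N" by (rule mult_mat_vec_carrier[OF PQ(4) v])
    have Dw: "?D *\<^sub>v ?w \<in> carrier_vec N" by (rule mult_mat_vec_carrier[OF rank_nf_carrier(1) w])
    have "commutation_mat r s A B *\<^sub>v vec_of_mat r s Y = P *\<^sub>v (?D *\<^sub>v ?w)"
      unfolding nf N_def[symmetric]
      using assoc_mult_mat_vec[OF mult_carrier_mat[OF PQ(1) rank_nf_carrier(1)] PQ(4) v]
        assoc_mult_mat_vec[OF PQ(1) rank_nf_carrier(1) w] by simp
    hence "A * Y = Y * B \<longleftrightarrow> P *\<^sub>v (?D *\<^sub>v ?w) = 0\<^sub>v N"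
      using commutation_mat_kernel_iff[OF A B Y] by (simp add: N_def)
    also have "\<dots> \<longleftrightarrow> ?D *\<^sub>v ?w = 0\<^sub>v N"
      using inv[OF PQ(1,2,3) Dw] mult0[OF PQ(1)] mult0[OF PQ(2)] by auto
    also have "\<dots> \<longleftrightarrow> (\<forall>i<N. i < k \<longrightarrow> ?w $ i = 0)"
      unfolding rank_nf_mult_vec[OF w] by (auto simp: vec_eq_iff)
    finally show ?thesis .
  qed
  have "dim_C A B \<le> card {k..<N}"
  proof (rule dim_C_le(2)[OF A B, of _ "\<lambda>Y i. (Q *\<^sub>v vec_of_mat r s Y) $ i"])
    fix Y Z :: "'a mat" and c i assume Y: "Y \<in> carrier_mat r s" and i: "i \<in> {k..<N}"
    have v: "vec_of_mat r s Y \<in> carrier_vec N" by (simp add: N_def)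
    have "vec_of_mat r s (c \<cdot>\<^sub>m Y) = c \<cdot>\<^sub>v vec_of_mat r s Y"
      by (rule eq_vecI) (use Y in \<open>auto simp: vec_of_mat_def div_mod_bounds\<close>)
    thus "(Q *\<^sub>v vec_of_mat r s (c \<cdot>\<^sub>m Y)) $ i = c * (Q *\<^sub>v vec_of_mat r s Y) $ i"
      using mult_mat_vec[OF PQ(4) v] PQ(4) i by simp
    assume Z: "Z \<in> carrier_mat r s"
    have v': "vec_of_mat r s Z \<in> carrier_vec N" by (simp add: N_def)
    have "vec_of_mat r s (Y + Z) = vec_of_mat r s Y + vec_of_mat r s Z"
      by (rule eq_vecI) (use Y Z in \<open>auto simp: vec_of_mat_def div_mod_bounds\<close>)
    thus "(Q *\<^sub>v vec_of_mat r s (Y + Z)) $ i = (Q *\<^sub>v vec_of_mat r s Y) $ i + (Q *\<^sub>v vec_of_mat r s Z) $ i"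
      using mult_add_distrib_mat_vec[OF PQ(4) v v'] PQ(4) i by simp
  next
    fix Y assume Y: "Y \<in> carrier_mat r s" and comm: "A * Y = Y * B"
      and z: "\<And>i. i \<in> {k..<N} \<Longrightarrow> (Q *\<^sub>v vec_of_mat r s Y) $ i = 0"
    have v: "vec_of_mat r s Y \<in> carrier_vec N" by (simp add: N_def)
    have "Q *\<^sub>v vec_of_mat r s Y = 0\<^sub>v N"
    proof (rule eq_vecI)
      fix i assume "i < dim_vec (0\<^sub>v N :: 'a vec)"
      thus "(Q *\<^sub>v vec_of_mat r s Y) $ i = 0\<^sub>v N $ i"
        using in_C[OF Y] comm z[of i] by (cases "i < k") auto
    qed (use PQ(4) in auto)
    hence "vec_of_mat r s Y = 0\<^sub>v N" using inv[OF PQ(4,5,7) v] mult0[OF PQ(5)] by simp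
    also have "0\<^sub>v N = vec_of_mat r s (0\<^sub>m r s)"
      by (rule eq_vecI) (auto simp: vec_of_mat_def N_def div_mod_bounds)
    finally show "Y = 0\<^sub>m r s" using vec_of_mat_eq_iff[OF Y zero_carrier_mat] by simp
  qed simp
  moreover have "card {k..<N} \<le> dim_C A B"
  proof -
    \<comment> \<open>Zero in the first \<open>k\<close> places and free in the others: exactly the
      vectors that solve the system in the coordinates given by \<open>Q\<close>.\<close>
    define u where "u = (\<lambda>c. vec N (\<lambda>i. if k \<le> i then c i else (0::'a)))"
    have u: "u c \<in> carrier_vec N" for c by (simp add: u_def)
    define g where "g = (\<lambda>c. mat_of_vec r s (Q' *\<^sub>v u c))"
    have Qu: "Q' *\<^sub>v u c \<in> carrier_vec N" for c by (rule mult_mat_vec_carrier[OF PQ(5) u])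
    have vg: "vec_of_mat r s (g c) = Q' *\<^sub>v u c" for c
      unfolding g_def by (rule vec_of_mat_of_vec[OF Qu[unfolded N_def]])
    have Qg: "Q *\<^sub>v vec_of_mat r s (g c) = u c" for c
      unfolding vg by (rule inv[OF PQ(5,4,6) u])
    have gc: "g c \<in> carrier_mat r s" for c by (simp add: g_def)
    show ?thesis
    proof (rule dim_C_ge[OF A B, of _ g])
      show "g c \<in> carrier_mat r s" for c by (rule gc)
      show "A * g c = g c * B" for c
        unfolding in_C[OF gc] Qg by (auto simp: u_def)
      show "g (\<lambda>i. c i + e i) = g c + g e" for c e
      proof -
        have "u (\<lambda>i. c i + e i) = u c + u e" by (rule eq_vecI) (auto simp: u_def)
        hence "Q' *\<^sub>v u (\<lambda>i. c i + e i) = Q' *\<^sub>v u c + Q' *\<^sub>v u e"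
          using mult_add_distrib_mat_vec[OF PQ(5) u u] by simp
        thus ?thesis unfolding g_def
          by (intro eq_matI) (use PQ(5) in \<open>auto simp: mat_of_vec_def N_def pair_bound\<close>)
      qed
      show "g (\<lambda>i. a * c i) = a \<cdot>\<^sub>m g c" for a c
      proof -
        have "u (\<lambda>i. a * c i) = a \<cdot>\<^sub>v u c" by (rule eq_vecI) (auto simp: u_def)
        hence "Q' *\<^sub>v u (\<lambda>i. a * c i) = a \<cdot>\<^sub>v (Q' *\<^sub>v u c)"
          using mult_mat_vec[OF PQ(5) u] by simp
        thus ?thesis unfolding g_def
          by (intro eq_matI) (use PQ(5) in \<open>auto simp: mat_of_vec_def N_def pair_bound\<close>)
      qed
      fix c i assume z: "g c = 0\<^sub>m r s" and i: "i \<in> {k..<N}"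
      have "vec_of_mat r s (0\<^sub>m r s) = (0\<^sub>v N :: 'a vec)"
        by (rule eq_vecI) (auto simp: vec_of_mat_def N_def div_mod_bounds)
      hence "u c = 0\<^sub>v N" using Qg[of c] mult0[OF PQ(4)] unfolding z by simp
      hence "u c $ i = 0" using i by simp
      thus "c i = 0" using i by (simp add: u_def)
    qed simp
  qed
  ultimately show ?thesis by (simp add: N_def)
qed

lemma to_ac_semiring_hom: "semiring_hom to_ac"
  by unfold_locales auto

text \<open>A factorisation of the commutation matrix through a rank normal form over the base field
  is mapped entrywise to one over the closure with the same \<open>k\<close>. Invertibility survives
  because it is given by explicit inverses, whose equations a homomorphism preserves.\<close>

lemma dim_C_to_ac:
  fixes A B :: "'a::field mat"
  assumes A: "A \<in> carrier_mat r r" and B: "B \<in> carrier_mat s s"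
  shows "dim_C (map_mat to_ac A) (map_mat to_ac B) = dim_C A B"
proof -
  interpret semiring_hom "to_ac :: 'a \<Rightarrow> _" by (rule to_ac_semiring_hom)
  let ?h = "map_mat to_ac" and ?N = "r * s"
  obtain P P' Q Q' k where
    P: "P \<in> carrier_mat ?N ?N" "P' \<in> carrier_mat ?N ?N" "P * P' = 1\<^sub>m ?N" "P' * P = 1\<^sub>m ?N"
    and Q: "Q \<in> carrier_mat ?N ?N" "Q' \<in> carrier_mat ?N ?N" "Q * Q' = 1\<^sub>m ?N" "Q' * Q = 1\<^sub>m ?N"
    and k: "k \<le> ?N" "k \<le> ?N" and nf: "commutation_mat r s A B = P * rank_nf ?N ?N k * Q"
    by (rule rank_normal_formE[OF commutation_mat_carrier])
  have "commutation_mat r s (?h A) (?h B) = ?h (commutation_mat r s A B)"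
    by (rule eq_matI) (use A B in \<open>auto simp: commutation_mat_def div_mod_bounds\<close>)
  also have "\<dots> = ?h P * rank_nf ?N ?N k * ?h Q"
  proof -
    have "?h (rank_nf ?N ?N k :: 'a mat) = rank_nf ?N ?N k" by (rule eq_matI) (auto simp: rank_nf_def)
    thus ?thesis unfolding nf mat_hom_mult[OF mult_carrier_mat[OF P(1) rank_nf_carrier(1)] Q(1)]
        mat_hom_mult[OF P(1) rank_nf_carrier(1)] by simp
  qed
  finally have nf': "commutation_mat r s (?h A) (?h B) = ?h P * rank_nf ?N ?N k * ?h Q" .
  have "?h P' * ?h P = 1\<^sub>m ?N" "?h Q * ?h Q' = 1\<^sub>m ?N" "?h Q' * ?h Q = 1\<^sub>m ?N"
    using mat_hom_mult[OF P(2,1)] mat_hom_mult[OF Q(1,2)] mat_hom_mult[OF Q(2,1)] P(4) Q(3,4)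
    by (simp_all add: mat_hom_one)
  hence "dim_C (?h A) (?h B) = ?N - k"
    using A B P Q by (intro dim_C_eq_corank[OF _ _ _ _ _ _ _ _ _ nf']) auto
  also have "\<dots> = dim_C A B"
    using dim_C_eq_corank[OF A B P(1,2,4) Q nf] by simp
  finally show ?thesis .
qed

section \<open>Jordan normal forms over algebraically closed fields\<close>

text \<open>Induction on the size by splitting off an eigenvector, which exists because the
  characteristic polynomial has a root. A basis containing it up to a scalar comes from the rank
  normal form of the one-column matrix \<open>M\<close>.\<close>

lemma alg_closed_triangularizable:
  fixes A :: "'a::alg_closed_field mat"
  assumes "A \<in> carrier_mat n n"
  shows "\<exists>T. T \<in> carrier_mat n n \<and> upper_triangular T \<and> similar_mat A T"
  using assms
proof (induction n arbitrary: A)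
  case 0
  thus ?case by (intro exI[of _ A]) (auto intro: similar_mat_refl)
next
  case (Suc m A)
  define n where "n = Suc m"
  have A: "A \<in> carrier_mat n n" using Suc.prems by (simp add: n_def)
  have "Polynomial.degree (char_poly A) > 0" using degree_monic_char_poly[OF A] by (simp add: n_def)
  then obtain e where "poly (char_poly A) e = 0" using alg_closed_imp_poly_has_root by blast
  hence "eigenvalue A e" using eigenvalue_root_char_poly[OF A] by simp
  then obtain v where v: "v \<in> carrier_vec n" "v \<noteq> 0\<^sub>v n" "A *\<^sub>v v = e \<cdot>\<^sub>v v"
    using A unfolding eigenvalue_def eigenvector_def by auto
  define M where "M = mat n 1 (\<lambda>(i,_). v $ i)"
  have M: "M \<in> carrier_mat n 1" by (simp add: M_def)
  have colM: "col M 0 = v" unfolding M_def by (rule eq_vecI) (use v in auto)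
  have AM: "A * M = e \<cdot>\<^sub>m M"
  proof (rule eq_matI)
    fix i j assume ij: "i < dim_row (e \<cdot>\<^sub>m M)" "j < dim_col (e \<cdot>\<^sub>m M)"
    hence "(A * M) $$ (i,j) = (A *\<^sub>v v) $ i" using A M colM by simp
    also have "\<dots> = (e \<cdot>\<^sub>m M) $$ (i,j)" unfolding v(3) using ij M v(1) by (simp add: M_def)
    finally show "(A * M) $$ (i,j) = (e \<cdot>\<^sub>m M) $$ (i,j)" .
  qed (use A M in auto)
  obtain P P' Q Q' k where
    P: "P \<in> carrier_mat n n" "P' \<in> carrier_mat n n" "P * P' = 1\<^sub>m n" "P' * P = 1\<^sub>m n"
    and Q: "Q \<in> carrier_mat 1 1" "Q' \<in> carrier_mat 1 1" "Q * Q' = 1\<^sub>m 1" "Q' * Q = 1\<^sub>m 1"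
    and k: "k \<le> n" "k \<le> 1" and nf: "M = P * rank_nf n 1 k * Q"
    by (rule rank_normal_formE[OF M])
  let ?D = "rank_nf n 1 k :: 'a mat"
  have D: "?D \<in> carrier_mat n 1" by simp
  have "k \<noteq> 0"
  proof
    assume "k = 0"
    hence "?D = 0\<^sub>m n 1" by (auto simp: rank_nf_def)
    hence M0: "M = 0\<^sub>m n 1" unfolding nf using P Q by simp
    have "v $ i = 0" if "i < n" for i
      using arg_cong[OF M0, of "\<lambda>M. M $$ (i,0)"] that by (simp add: M_def)
    thus False using v(1,2) by auto
  qed
  hence k1: "k = 1" using k by simp
  define B where "B = P' * A * P"
  have B: "B \<in> carrier_mat n n" unfolding B_def using P A by simp
  \<comment> \<open>\<open>Q\<close> is a 1 by 1 matrix, so removing it merely rescales the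
    eigenvector: the first column of \<open>P\<close> is a nonzero multiple of
    \<open>v\<close>.\<close>
  have MQ: "M * Q' = P * ?D"
  proof -
    have "M * Q' = P * ?D * (Q * Q')" unfolding nf
      by (rule assoc_mult_mat[OF mult_carrier_mat[OF P(1) D] Q(1,2)])
    thus ?thesis unfolding Q(3) using P by simp
  qed
  \<comment> \<open>As \<open>k = 1\<close>, the matrix \<open>?D\<close> is the first unit vector,
    so this computes the first column of \<open>B\<close> and shows that it is \<open>e\<close>
    times that unit vector.\<close>
  have "B * ?D = P' * A * (P * ?D)" unfolding B_def
    by (rule assoc_mult_mat[OF mult_carrier_mat[OF P(2) A] P(1) D])
  also have "\<dots> = P' * (A * (M * Q'))" unfolding MQ
    by (rule assoc_mult_mat[OF P(2) A mult_carrier_mat[OF P(1) D]])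
  also have "A * (M * Q') = A * M * Q'" by (rule assoc_mult_mat[symmetric, OF A M Q(2)])
  also have "\<dots> = e \<cdot>\<^sub>m (P * ?D)" unfolding AM MQ[symmetric] by (rule mult_smult_assoc_mat[OF M Q(2)])
  also have "P' * (e \<cdot>\<^sub>m (P * ?D)) = e \<cdot>\<^sub>m (P' * (P * ?D))"
    by (rule mult_smult_distrib[OF P(2) mult_carrier_mat[OF P(1) D]])
  also have "P' * (P * ?D) = ?D"
    using assoc_mult_mat[OF P(2,1) D] P(4) by simp
  finally have BD: "mat n 1 (\<lambda>(i,j). if j < k \<and> j < n then B $$ (i,j) else 0) = e \<cdot>\<^sub>m ?D"
    unfolding rank_nf_mult_right[OF B] .
  have B0: "B $$ (i,0) = 0" if "0 < i" "i < n" for i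
    using arg_cong[OF BD, of "\<lambda>M. M $$ (i,0)"] that k1 by (simp add: rank_nf_def)
  have Aeq: "A = P * B * P'"
  proof -
    have "P * B * P' = P * (P' * A * P) * P'" by (simp add: B_def)
    also have "\<dots> = (P * P') * A * (P * P')"
      using carrier_matD[OF P(1)] carrier_matD[OF P(2)] carrier_matD[OF A] by (simp add: mat_assoc)
    also have "\<dots> = A" unfolding P(3) using A by simp
    finally show ?thesis ..
  qed
  have sim: "similar_mat A B" unfolding similar_mat_def
    using similar_mat_witI[OF P(3,4) Aeq A B P(1,2)] by blast
  obtain B1 B2 B3 B4 where spl: "split_block B 1 1 = (B1,B2,B3,B4)" by (metis prod_cases4)
  have blk: "B1 \<in> carrier_mat 1 1" "B2 \<in> carrier_mat 1 m" "B3 \<in> carrier_mat m 1" "B4 \<in> carrier_mat m m"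
    and Bb: "B = four_block_mat B1 B2 B3 B4"
    using split_block[OF spl, of m m] B by (auto simp: n_def)
  have B3: "B3 = 0\<^sub>m m 1"
  proof (rule eq_matI)
    fix i j assume "i < dim_row (0\<^sub>m m 1 :: 'a mat)" "j < dim_col (0\<^sub>m m 1 :: 'a mat)"
    hence ij: "i < m" "j = 0" by auto
    have "B $$ (Suc i, 0) = B3 $$ (i,0)" unfolding Bb using blk ij by auto
    thus "B3 $$ (i,j) = 0\<^sub>m m 1 $$ (i,j)" using B0[of "Suc i"] ij by (simp add: n_def)
  qed (use blk in auto)
  obtain T where T: "T \<in> carrier_mat m m" "upper_triangular T" "similar_mat B4 T"
    using Suc.IH[OF blk(4)] by blast
  \<comment> \<open>A similarity of the lower diagonal block extends to the whole block triangular
    matrix, at the cost of a new upper right block \<open>U\<close>.\<close>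
  obtain U where U: "U \<in> carrier_mat 1 m"
    and simU: "similar_mat (four_block_mat B1 B2 (0\<^sub>m m 1) B4) (four_block_mat B1 U (0\<^sub>m m 1) T)"
    using similar_mat_four_block_0_ex[OF similar_mat_refl[OF blk(1)] T(3) blk(2,1,4)] by blast
  let ?T = "four_block_mat B1 U (0\<^sub>m m 1) T"
  have "similar_mat A ?T" using similar_mat_trans[OF sim] simU Bb B3 by simp
  moreover have "upper_triangular ?T"
    by (rule upper_triangular_four_block[OF blk(1) T(1) _ T(2)]) (use blk in auto)
  moreover have "?T \<in> carrier_mat (Suc m) (Suc m)" using blk T by auto
  ultimately show ?case by blast
qed

lemma alg_closed_jordan_nf_exists:
  fixes A :: "'a::alg_closed_field mat"
  assumes "A \<in> carrier_mat n n"
  shows "\<exists>n_as. jordan_nf A n_as"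
proof -
  obtain T where T: "T \<in> carrier_mat n n" "upper_triangular T" "similar_mat A T"
    using alg_closed_triangularizable[OF assms] by blast
  have "jordan_nf T (triangular_to_jnf_vector T)" by (rule triangular_to_jnf_vector[OF T(1,2)])
  hence "jordan_nf A (triangular_to_jnf_vector T)"
    unfolding jordan_nf_def using similar_mat_trans[OF T(3)] by simp
  thus ?thesis by blast
qed

section \<open>Eigenspace dimensions counted on the diagonal of a Jordan matrix\<close>

text \<open>With both flags unset these are the diagonal positions carrying \<open>\<alpha>\<close>; in a Jordan matrix the
  first flag selects the starts and the second flag the ends of the Jordan blocks.\<close>

definition diag_positions :: "bool \<Rightarrow> bool \<Rightarrow> 'a::zero mat \<Rightarrow> 'a \<Rightarrow> nat set" where
  "diag_positions c r M \<alpha> = {i. i < dim_row M \<and> M $$ (i,i) = \<alpha> \<and>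
     (c \<longrightarrow> (\<forall>k<dim_row M. k \<noteq> i \<longrightarrow> M $$ (k,i) = 0)) \<and>
     (r \<longrightarrow> (\<forall>k<dim_row M. k \<noteq> i \<longrightarrow> M $$ (i,k) = 0))}"

lemma finite_diag_positions[simp]: "finite (diag_positions c r M \<alpha>)"
  by (simp add: diag_positions_def)

text \<open>The off-diagonal blocks are zero, so the row and column conditions at a position only
  concern the diagonal block that contains it.\<close>

lemma card_diag_positions_four_block:
  assumes A: "A \<in> carrier_mat n n" and D: "D \<in> carrier_mat m m"
  shows "card (diag_positions c r (four_block_mat A (0\<^sub>m n m) (0\<^sub>m m n) D) \<alpha>) =
    card (diag_positions c r A \<alpha>) + card (diag_positions c r D \<alpha>)"
proof -
  let ?F = "four_block_mat A (0\<^sub>m n m) (0\<^sub>m m n) D"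
  have split: "(\<forall>k<n + m. \<phi> k) \<longleftrightarrow> (\<forall>k<n. \<phi> k) \<and> (\<forall>k<m. \<phi> (n + k))" for \<phi> :: "nat \<Rightarrow> bool"
  proof (intro iffI conjI allI impI)
    fix k assume "(\<forall>k<n. \<phi> k) \<and> (\<forall>k<m. \<phi> (n + k))" "k < n + m"
    thus "\<phi> k" by (cases "k < n") (auto dest: spec[of _ "k - n"])
  qed auto
  have dims: "dim_row A = n" "dim_col A = n" "dim_row D = m" "dim_col D = m" "dim_row ?F = n + m"
    using A D by auto
  have entries: "i < n \<Longrightarrow> k < n \<Longrightarrow> ?F $$ (i,k) = A $$ (i,k)" "i < n \<Longrightarrow> k < m \<Longrightarrow> ?F $$ (i,n+k) = 0"
    "i < m \<Longrightarrow> k < n \<Longrightarrow> ?F $$ (n+i,k) = 0" "i < m \<Longrightarrow> k < m \<Longrightarrow> ?F $$ (n+i,n+k) = D $$ (i,k)" for i k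
    by (simp_all add: dims)
  have lo: "i \<in> diag_positions c r ?F \<alpha> \<longleftrightarrow> i \<in> diag_positions c r A \<alpha>" if "i < n" for i
    unfolding diag_positions_def mem_Collect_eq dims split using that
    by (simp add: entries cong: conj_cong)
  have hi: "n + i \<in> diag_positions c r ?F \<alpha> \<longleftrightarrow> i \<in> diag_positions c r D \<alpha>" for i
    unfolding diag_positions_def mem_Collect_eq dims split
    by (cases "i < m") (simp_all add: entries cong: conj_cong)
  have bA: "i < n" if "i \<in> diag_positions c r A \<alpha>" for i
    using that A by (simp add: diag_positions_def)
  have "diag_positions c r ?F \<alpha> = diag_positions c r A \<alpha> \<union> (+) n ` diag_positions c r D \<alpha>"
  proof (rule Set.set_eqI)
    fix i
    show "i \<in> diag_positions c r ?F \<alpha> \<longleftrightarrow> i \<in> diag_positions c r A \<alpha> \<union> (+) n ` diag_positions c r D \<alpha>"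
    proof (cases "i < n")
      case True
      thus ?thesis using lo by auto
    next
      case False
      then obtain k where "i = n + k" using le_Suc_ex not_le by blast
      thus ?thesis using hi[of k] bA False by auto
    qed
  qed
  moreover have "diag_positions c r A \<alpha> \<inter> (+) n ` diag_positions c r D \<alpha> = {}"
    using bA by auto
  ultimately show ?thesis by (simp add: card_Un_disjoint card_image)
qed

text \<open>The ones on the superdiagonal hit every column but the first and every row but the last.
  The form \<open>min 1 n\<close> covers the empty block and fits the formula for generalized
  eigenspaces.\<close>

lemma card_diag_positions_jordan_block:
  "card (diag_positions False False (jordan_block n a) \<alpha>) = (if a = \<alpha> then n else 0)"
  "card (diag_positions True False (jordan_block n a) \<alpha>) = (if a = \<alpha> then min 1 n else 0)"
  "card (diag_positions False True (jordan_block n a) \<alpha>) = (if a = (\<alpha>::'a::zero_neq_one) then min 1 n else 0)"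
proof -
  have "diag_positions False False (jordan_block n a) \<alpha> = (if a = \<alpha> then {..<n} else {})"
    by (auto simp: diag_positions_def)
  thus "card (diag_positions False False (jordan_block n a) \<alpha>) = (if a = \<alpha> then n else 0)" by simp
  have start: "(\<forall>k<n. k \<noteq> i \<longrightarrow> jordan_block n a $$ (k,i) = 0) \<longleftrightarrow> i = 0" if "i < n" for i
  proof
    assume *: "\<forall>k<n. k \<noteq> i \<longrightarrow> jordan_block n a $$ (k,i) = 0"
    show "i = 0"
    proof (cases i)
      case (Suc k)
      thus ?thesis using *[rule_format, of k] that by simp
    qed
  qed (use that in auto)
  have "diag_positions True False (jordan_block n a) \<alpha> = (if a = \<alpha> \<and> n > 0 then {0} else {})"
  proof (rule Set.set_eqI)
    fix i
    show "i \<in> diag_positions True False (jordan_block n a) \<alpha> \<longleftrightarrow> i \<in> (if a = \<alpha> \<and> n > 0 then {0} else {})"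
    proof (cases "i < n")
      case True
      show ?thesis unfolding diag_positions_def mem_Collect_eq jordan_block_index(2) start[OF True]
        using True by auto
    qed (auto simp: diag_positions_def)
  qed
  thus "card (diag_positions True False (jordan_block n a) \<alpha>) = (if a = \<alpha> then min 1 n else 0)" by auto
  have stop: "(\<forall>k<n. k \<noteq> i \<longrightarrow> jordan_block n a $$ (i,k) = 0) \<longleftrightarrow> i = n - 1" if "i < n" for i
  proof
    assume *: "\<forall>k<n. k \<noteq> i \<longrightarrow> jordan_block n a $$ (i,k) = 0"
    show "i = n - 1"
    proof (rule ccontr)
      assume "i \<noteq> n - 1"
      hence "Suc i < n" using that by simp
      thus False using *[rule_format, of "Suc i"] that by simp
    qed
  qed (use that in auto)
  have "diag_positions False True (jordan_block n a) \<alpha> = (if a = \<alpha> \<and> n > 0 then {n - 1} else {})"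
  proof (rule Set.set_eqI)
    fix i
    show "i \<in> diag_positions False True (jordan_block n a) \<alpha> \<longleftrightarrow> i \<in> (if a = \<alpha> \<and> n > 0 then {n - 1} else {})"
    proof (cases "i < n")
      case True
      show ?thesis unfolding diag_positions_def mem_Collect_eq jordan_block_index(2) stop[OF True]
        using True by auto
    qed (auto simp: diag_positions_def)
  qed
  thus "card (diag_positions False True (jordan_block n a) \<alpha>) = (if a = \<alpha> then min 1 n else 0)" by auto
qed

lemma jordan_matrix_Cons_four_block:
  "jordan_matrix ((n,a) # n_as) = four_block_mat (jordan_block n a) (0\<^sub>m n (sum_list (map fst n_as)))
     (0\<^sub>m (sum_list (map fst n_as)) n) (jordan_matrix n_as)"
  using jordan_matrix_dim[of n_as] unfolding jordan_matrix_def by (simp add: Let_def)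

text \<open>Both sides are additive over the blocks, and a block of size \<open>n\<close> with
  eigenvalue \<alpha> contributes \<open>min k n\<close> to the generalized eigenspace of exponent
  \<open>k\<close>. It therefore suffices to compare single blocks.\<close>

lemma card_diag_positions_jordan_matrix:
  fixes n_as :: "(nat \<times> 'a::field) list"
  assumes "\<And>n a. (n,a) \<in> set n_as \<Longrightarrow>
    card (diag_positions c r (jordan_block n a) \<alpha>) = (if a = \<alpha> then min k n else 0)"
  shows "card (diag_positions c r (jordan_matrix n_as) \<alpha>) = dim_gen_eigenspace (jordan_matrix n_as) \<alpha> k"
  unfolding dim_gen_eigenspace_jordan_matrix using assms
proof (induction n_as)
  case Nil
  show ?case by (simp add: diag_positions_def)
next
  case (Cons na n_as)
  obtain n a where na: "na = (n,a)" by force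
  have "card (diag_positions c r (jordan_matrix n_as) \<alpha>) = (\<Sum>n\<leftarrow>map fst [(n, e)\<leftarrow>n_as . e = \<alpha>]. min k n)"
    by (rule Cons.IH) (rule Cons.prems, simp)
  moreover have "card (diag_positions c r (jordan_block n a) \<alpha>) = (if a = \<alpha> then min k n else 0)"
    by (rule Cons.prems) (simp add: na)
  ultimately show ?case unfolding na jordan_matrix_Cons_four_block
      card_diag_positions_four_block[OF jordan_block_carrier jordan_matrix_carrier] by simp
qed

text \<open>Dimensions of generalized eigenspaces are invariant under similarity. Exponent
  \<open>n\<close> yields the algebraic and exponent 1 the geometric multiplicity; the latter is
  counted by block starts and also by block ends.\<close>

lemma jordan_nf_multiplicities:
  fixes A :: "'a::field mat"
  assumes A: "A \<in> carrier_mat n n" and nf: "jordan_nf A n_as"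
  shows "dim_gen_eigenspace A \<alpha> n = card (diag_positions False False (jordan_matrix n_as) \<alpha>)"
    and "kernel_dim (char_matrix A \<alpha>) = card (diag_positions True False (jordan_matrix n_as) \<alpha>)"
    and "kernel_dim (char_matrix A \<alpha>) = card (diag_positions False True (jordan_matrix n_as) \<alpha>)"
proof -
  have sim: "similar_mat A (jordan_matrix n_as)" using nf unfolding jordan_nf_def by simp
  then obtain P Q where "similar_mat_wit A (jordan_matrix n_as) P Q" unfolding similar_mat_def by blast
  from similar_mat_witD2(5)[OF A this] have n: "sum_list (map fst n_as) = n"
    using carrier_matD(1) by force
  \<comment> \<open>No block is larger than the matrix, so with exponent \<open>n\<close> each block
    contributes its full size.\<close>
  have le: "k \<le> n" if "(k,a) \<in> set n_as" for k a
    using that member_le_sum_list[of k "map fst n_as"] n by force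
  have "kernel_dim (char_matrix A \<alpha>) = dim_gen_eigenspace A \<alpha> 1"
    unfolding dim_gen_eigenspace_def using A by (simp add: char_matrix_def)
  moreover note dim_gen_eigenspace_similar[OF sim]
  moreover have "card (diag_positions False False (jordan_matrix n_as) \<alpha>) = dim_gen_eigenspace (jordan_matrix n_as) \<alpha> n"
    by (rule card_diag_positions_jordan_matrix) (simp add: card_diag_positions_jordan_block min_absorb2 le)
  moreover have "card (diag_positions True False (jordan_matrix n_as) \<alpha>) = dim_gen_eigenspace (jordan_matrix n_as) \<alpha> 1"
    "card (diag_positions False True (jordan_matrix n_as) \<alpha>) = dim_gen_eigenspace (jordan_matrix n_as) \<alpha> 1"
    by (rule card_diag_positions_jordan_matrix, simp add: card_diag_positions_jordan_block)+
  ultimately show "dim_gen_eigenspace A \<alpha> n = card (diag_positions False False (jordan_matrix n_as) \<alpha>)"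
    "kernel_dim (char_matrix A \<alpha>) = card (diag_positions True False (jordan_matrix n_as) \<alpha>)"
    "kernel_dim (char_matrix A \<alpha>) = card (diag_positions False True (jordan_matrix n_as) \<alpha>)"
    by simp_all
qed

section \<open>The eigenvalue bounds\<close>

text \<open>Once the entries of \<open>Y\<close> below (i,j) in its column and to the left in its
  row are known to be 0, the (i,j) entry of the equation reads
  \<open>J $$ (i,i) * Y $$ (i,j) = Y $$ (i,j) * K $$ (j,j)\<close>. Hence \<open>Y $$ (i,j)\<close>
  is 0 unless the diagonal entries agree.\<close>

lemma upper_triangular_intertwiner_zero:
  fixes J K :: "'a::field mat"
  assumes J: "J \<in> carrier_mat r r" "upper_triangular J" and K: "K \<in> carrier_mat s s" "upper_triangular K"
    and Y: "Y \<in> carrier_mat r s" and comm: "J * Y = Y * K"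
    and z: "\<And>i j. i < r \<Longrightarrow> j < s \<Longrightarrow> J $$ (i,i) = K $$ (j,j) \<Longrightarrow> Y $$ (i,j) = 0"
  shows "Y = 0\<^sub>m r s"
proof -
  have "Y $$ (i,j) = 0" if "i < r" "j < s" for i j
    using that
  \<comment> \<open>The measure decreases on going down or to the left, so the induction starts in
    the lower left corner.\<close>
  proof (induction "(r - i) + j" arbitrary: i j rule: less_induct)
    case (less i j)
    have "(J * Y) $$ (i,j) = (\<Sum>k<r. J $$ (i,k) * Y $$ (k,j))"
      using J Y less.prems by (simp add: scalar_prod_def atLeast0LessThan)
    also have "\<dots> = (\<Sum>k<r. if k = i then J $$ (i,i) * Y $$ (i,j) else 0)"
    proof (intro sum.cong refl)
      fix k assume k: "k \<in> {..<r}"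
      have "J $$ (i,k) = 0" if "k < i" using J less.prems that unfolding upper_triangular_def by auto
      moreover have "Y $$ (k,j) = 0" if "k > i"
        using less.hyps[of k j] less.prems that k by simp
      ultimately show "J $$ (i,k) * Y $$ (k,j) = (if k = i then J $$ (i,i) * Y $$ (i,j) else 0)"
        by (cases k i rule: linorder_cases) auto
    qed
    also have "\<dots> = J $$ (i,i) * Y $$ (i,j)" using less.prems by simp
    finally have 1: "(J * Y) $$ (i,j) = J $$ (i,i) * Y $$ (i,j)" .
    have "(Y * K) $$ (i,j) = (\<Sum>k<s. Y $$ (i,k) * K $$ (k,j))"
      using K Y less.prems by (simp add: scalar_prod_def atLeast0LessThan)
    also have "\<dots> = (\<Sum>k<s. if k = j then Y $$ (i,j) * K $$ (j,j) else 0)"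
    proof (intro sum.cong refl)
      fix k assume k: "k \<in> {..<s}"
      have "K $$ (k,j) = 0" if "j < k" using K k that unfolding upper_triangular_def by auto
      moreover have "Y $$ (i,k) = 0" if "k < j"
        using less.hyps[of i k] less.prems that k by simp
      ultimately show "Y $$ (i,k) * K $$ (k,j) = (if k = j then Y $$ (i,j) * K $$ (j,j) else 0)"
        by (cases k j rule: linorder_cases) auto
    qed
    also have "\<dots> = Y $$ (i,j) * K $$ (j,j)" using less.prems by simp
    finally have "(Y * K) $$ (i,j) = Y $$ (i,j) * K $$ (j,j)" .
    with 1 have "Y $$ (i,j) = 0 \<or> J $$ (i,i) = K $$ (j,j)"
      unfolding comm by (metis mult.commute mult_cancel_left)
    thus ?case using z[OF less.prems] by blast
  qed
  thus ?thesis using Y by (intro eq_matI) auto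
qed

text \<open>The substitution \<open>W = P' * Y * R\<close> turns \<open>A * Y = Y * B\<close> into
  \<open>J * W = W * K\<close>; the entries of \<open>W\<close> at positions with equal diagonal
  values then determine \<open>Y\<close>.\<close>

lemma dim_C_le_similar_triangular:
  fixes A B :: "'a::field mat"
  assumes A: "A \<in> carrier_mat r r" and B: "B \<in> carrier_mat s s"
    and simA: "similar_mat A J" and simB: "similar_mat B K"
    and J: "upper_triangular J" and K: "upper_triangular K"
  shows "dim_C A B \<le> card {(i,j). i < r \<and> j < s \<and> J $$ (i,i) = K $$ (j,j)}"
proof -
  obtain P P' where "similar_mat_wit A J P P'" using simA unfolding similar_mat_def by blast
  from similar_mat_witD2[OF A this] have
    P: "P \<in> carrier_mat r r" "P' \<in> carrier_mat r r" "P * P' = 1\<^sub>m r" "P' * P = 1\<^sub>m r"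
    and Jc: "J \<in> carrier_mat r r" and Aeq: "A = P * J * P'" by auto
  obtain R R' where "similar_mat_wit B K R R'" using simB unfolding similar_mat_def by blast
  from similar_mat_witD2[OF B this] have
    R: "R \<in> carrier_mat s s" "R' \<in> carrier_mat s s" "R * R' = 1\<^sub>m s" "R' * R = 1\<^sub>m s"
    and Kc: "K \<in> carrier_mat s s" and Beq: "B = R * K * R'" by auto
  note d = carrier_matD[OF P(1)] carrier_matD[OF P(2)] carrier_matD[OF R(1)] carrier_matD[OF R(2)]
    carrier_matD[OF Jc] carrier_matD[OF Kc]
  note canc = mult_cancel_left_inverse[OF P(3,2) _ P(1)] mult_cancel_left_inverse[OF P(4,1) _ P(2)]
    mult_cancel_left_inverse[OF R(3,2) _ R(1)] mult_cancel_left_inverse[OF R(4,1) _ R(2)]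
  let ?S = "{(i,j). i < r \<and> j < s \<and> J $$ (i,i) = K $$ (j,j)}"
  show ?thesis
  proof (rule dim_C_le(2)[OF A B, of _ "\<lambda>Y ij. (P' * Y * R) $$ ij"])
    show "finite ?S" by (rule finite_subset[of _ "{..<r} \<times> {..<s}"]) auto
    fix Y Z :: "'a mat" and c p assume Y: "Y \<in> carrier_mat r s" and p: "p \<in> ?S"
    show "(P' * (Y + Z) * R) $$ p = (P' * Y * R) $$ p + (P' * Z * R) $$ p" if "Z \<in> carrier_mat r s"
      unfolding sandwich_linear(1)[OF P(2) R(1) Y that] using p by (auto simp: d)
    show "(P' * (c \<cdot>\<^sub>m Y) * R) $$ p = c * (P' * Y * R) $$ p"
      unfolding sandwich_linear(2)[OF P(2) R(1) Y Y] using p by (auto simp: d)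
  next
    fix Y assume Y: "Y \<in> carrier_mat r s" and comm: "A * Y = Y * B"
      and z: "\<And>p. p \<in> ?S \<Longrightarrow> (P' * Y * R) $$ p = 0"
    note dY = carrier_matD[OF Y]
    define W where "W = P' * Y * R"
    have W: "W \<in> carrier_mat r s" unfolding W_def
      by (rule mult_carrier_mat[OF mult_carrier_mat[OF P(2) Y] R(1)])
    have "J * W = P' * (A * Y) * R" unfolding W_def Aeq by (simp add: mat_assoc d dY canc)
    also have "\<dots> = W * K" unfolding W_def comm Beq using R(4) Kc by (simp add: mat_assoc d dY canc)
    finally have "J * W = W * K" .
    from upper_triangular_intertwiner_zero[OF Jc J Kc K W this]
    have "W = 0\<^sub>m r s" using z unfolding W_def by auto
    moreover have "Y = P * W * R'" unfolding W_def using R(3) Y by (simp add: mat_assoc d dY canc)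
    ultimately show "Y = 0\<^sub>m r s" by (simp add: d)
  qed
qed

text \<open>For the matrix unit at (i,j) in \<open>S\<close>, multiplying by \<open>J\<close> puts
  column \<open>i\<close> of \<open>J\<close> into column \<open>j\<close>, and multiplying by
  \<open>K\<close> puts row \<open>j\<close> of \<open>K\<close> into row \<open>i\<close>. By
  \<open>SJ\<close> and \<open>SK\<close> only the diagonal entries remain, and these agree by
  \<open>SJK\<close>.\<close>

lemma dim_C_ge_similar:
  fixes A B :: "'a::field mat"
  assumes A: "A \<in> carrier_mat r r" and B: "B \<in> carrier_mat s s"
    and simA: "similar_mat A J" and simB: "similar_mat B K"
    and S: "S \<subseteq> {..<r} \<times> {..<s}"
    and SJ: "\<And>i j k. (i,j) \<in> S \<Longrightarrow> k < r \<Longrightarrow> k \<noteq> i \<Longrightarrow> J $$ (k,i) = 0"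
    and SK: "\<And>i j k. (i,j) \<in> S \<Longrightarrow> k < s \<Longrightarrow> k \<noteq> j \<Longrightarrow> K $$ (j,k) = 0"
    and SJK: "\<And>i j. (i,j) \<in> S \<Longrightarrow> J $$ (i,i) = K $$ (j,j)"
  shows "card S \<le> dim_C A B"
proof -
  obtain P P' where "similar_mat_wit A J P P'" using simA unfolding similar_mat_def by blast
  from similar_mat_witD2[OF A this] have
    P: "P \<in> carrier_mat r r" "P' \<in> carrier_mat r r" "P * P' = 1\<^sub>m r" "P' * P = 1\<^sub>m r"
    and Jc: "J \<in> carrier_mat r r" and Aeq: "A = P * J * P'" by auto
  obtain R R' where "similar_mat_wit B K R R'" using simB unfolding similar_mat_def by blast
  from similar_mat_witD2[OF B this] have
    R: "R \<in> carrier_mat s s" "R' \<in> carrier_mat s s" "R * R' = 1\<^sub>m s" "R' * R = 1\<^sub>m s"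
    and Kc: "K \<in> carrier_mat s s" and Beq: "B = R * K * R'" by auto
  note d = carrier_matD[OF P(1)] carrier_matD[OF P(2)] carrier_matD[OF R(1)] carrier_matD[OF R(2)]
    carrier_matD[OF Jc] carrier_matD[OF Kc]
  note canc = mult_cancel_left_inverse[OF P(3,2) _ P(1)] mult_cancel_left_inverse[OF P(4,1) _ P(2)]
    mult_cancel_left_inverse[OF R(3,2) _ R(1)] mult_cancel_left_inverse[OF R(4,1) _ R(2)]
  define E where "E = (\<lambda>c. mat r s (\<lambda>p. if p \<in> S then c p else (0::'a)))"
  have E: "E c \<in> carrier_mat r s" for c by (simp add: E_def)
  note dE = carrier_matD[OF E]
  have JE: "J * E c = E c * K" for c
  proof (rule eq_matI)
    fix i j assume "i < dim_row (E c * K)" "j < dim_col (E c * K)"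
    hence ij: "i < r" "j < s" using dE d by auto
    have "(J * E c) $$ (i,j) = (\<Sum>k<r. J $$ (i,k) * E c $$ (k,j))"
      using Jc ij dE by (simp add: scalar_prod_def atLeast0LessThan)
    also have "\<dots> = (\<Sum>k<r. if k = i then J $$ (i,i) * E c $$ (i,j) else 0)"
      by (intro sum.cong refl) (use ij SJ in \<open>auto simp: E_def\<close>)
    also have "\<dots> = J $$ (i,i) * E c $$ (i,j)" using ij by simp
    also have "\<dots> = E c $$ (i,j) * K $$ (j,j)" using ij SJK by (auto simp: E_def)
    also have "\<dots> = (\<Sum>k<s. if k = j then E c $$ (i,j) * K $$ (j,j) else 0)" using ij by simp
    also have "\<dots> = (\<Sum>k<s. E c $$ (i,k) * K $$ (k,j))"
      by (intro sum.cong refl) (use ij SK in \<open>auto simp: E_def\<close>)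
    also have "\<dots> = (E c * K) $$ (i,j)"
      using Kc ij dE by (simp add: scalar_prod_def atLeast0LessThan)
    finally show "(J * E c) $$ (i,j) = (E c * K) $$ (i,j)" .
  qed (use d dE in auto)
  show ?thesis
  proof (rule dim_C_ge[OF A B, of _ "\<lambda>c. P * E c * R'"])
    show "finite S" using S by (rule finite_subset) simp
    show "P * E c * R' \<in> carrier_mat r s" for c
      by (rule mult_carrier_mat[OF mult_carrier_mat[OF P(1) E] R(2)])
    show "A * (P * E c * R') = P * E c * R' * B" for c
    proof -
      have "A * (P * E c * R') = P * (J * E c) * R'"
        unfolding Aeq by (simp add: mat_assoc d dE canc)
      also have "\<dots> = P * E c * R' * B"
        unfolding JE Beq by (simp add: mat_assoc d dE canc)
      finally show ?thesis .
    qed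
    show "P * E (\<lambda>i. c i + e i) * R' = P * E c * R' + P * E e * R'" for c e
    proof -
      have "E (\<lambda>i. c i + e i) = E c + E e" by (rule eq_matI) (auto simp: E_def)
      thus ?thesis using sandwich_linear(1)[OF P(1) R(2) E E] by simp
    qed
    show "P * E (\<lambda>i. k * c i) * R' = k \<cdot>\<^sub>m (P * E c * R')" for k c
    proof -
      have "E (\<lambda>i. k * c i) = k \<cdot>\<^sub>m E c" by (rule eq_matI) (auto simp: E_def)
      thus ?thesis using sandwich_linear(2)[OF P(1) R(2) E E] by simp
    qed
    fix c p assume z: "P * E c * R' = 0\<^sub>m r s" and p: "p \<in> S"
    have "E c = P' * (P * E c * R') * R" using R(4) E[of c] by (simp add: mat_assoc d dE canc)
    also have "\<dots> = 0\<^sub>m r s" unfolding z by (simp add: d)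
    finally have "E c $$ p = 0" using p S by auto
    thus "c p = 0" using p S by (auto simp: E_def)
  qed
qed

text \<open>The set of pairs is the disjoint union, over the common values \<alpha>, of products of
  fibres. Summing only over nonzero products keeps the index set finite; over an infinite set the
  sum would be 0 by convention.\<close>

lemma card_fibre_product:
  fixes m n :: "'b \<Rightarrow> nat"
  assumes U: "finite U" and W: "finite W"
    and m: "\<And>\<alpha>. m \<alpha> = card {i \<in> U. f i = \<alpha>}" and n: "\<And>\<alpha>. n \<alpha> = card {j \<in> W. g j = \<alpha>}"
  shows "card {(i,j). i \<in> U \<and> j \<in> W \<and> f i = g j} = (\<Sum>\<alpha>\<in>{\<alpha>. m \<alpha> * n \<alpha> \<noteq> 0}. m \<alpha> * n \<alpha>)"
proof -
  let ?I = "{\<alpha>. m \<alpha> * n \<alpha> \<noteq> 0}" and ?F = "\<lambda>\<alpha>. {i \<in> U. f i = \<alpha>} \<times> {j \<in> W. g j = \<alpha>}"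
  have "?I \<subseteq> f ` U"
  proof
    fix \<alpha> assume "\<alpha> \<in> ?I"
    hence "card {i \<in> U. f i = \<alpha>} \<noteq> 0" using m by simp
    hence "{i \<in> U. f i = \<alpha>} \<noteq> {}" by (metis card.empty)
    thus "\<alpha> \<in> f ` U" by auto
  qed
  hence fin: "finite ?I" using U by (meson finite_imageI finite_subset)
  have "{(i,j). i \<in> U \<and> j \<in> W \<and> f i = g j} = (\<Union>\<alpha>\<in>?I. ?F \<alpha>)"
  proof (intro equalityI subsetI)
    fix p assume "p \<in> {(i,j). i \<in> U \<and> j \<in> W \<and> f i = g j}"
    then obtain i j where p: "p = (i,j)" "i \<in> U" "j \<in> W" "f i = g j" by auto
    hence "i \<in> {i \<in> U. f i = f i}" "p \<in> ?F (f i)" by auto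
    hence "card {i' \<in> U. f i' = f i} \<noteq> 0" "card {j \<in> W. g j = f i} \<noteq> 0"
      using U W p by auto
    hence "f i \<in> ?I" using m n by simp
    thus "p \<in> (\<Union>\<alpha>\<in>?I. ?F \<alpha>)" using \<open>p \<in> ?F (f i)\<close> by blast
  qed auto
  also have "card \<dots> = (\<Sum>\<alpha>\<in>?I. card (?F \<alpha>))"
    by (rule card_UN_disjoint[OF fin]) (use U W in auto)
  finally show ?thesis by (simp only: card_cartesian_product m n)
qed

theorem theorem5p1:
  fixes A B :: "'a::field mat" and r s :: nat
  assumes "A \<in> carrier_mat r r" and "B \<in> carrier_mat s s"
  shows "(\<Sum>\<alpha> \<in> {\<alpha>. k_eig A \<alpha> * k_eig B \<alpha> \<noteq> 0}. k_eig A \<alpha> * k_eig B \<alpha>) \<le> dim_C A B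
       \<and> dim_C A B \<le> (\<Sum>\<alpha> \<in> {\<alpha>. m_eig A \<alpha> * m_eig B \<alpha> \<noteq> 0}. m_eig A \<alpha> * m_eig B \<alpha>)
       \<and> (r - Rk A) * (s - Rk B) \<le> dim_C A B
       \<and> dim_C A B \<le> (r - Rk A) * (s - Rk B) + Rk A * Rk B"
proof -
  note A = assms(1) and B = assms(2)
  define A' where "A' = map_mat to_ac A"
  define B' where "B' = map_mat to_ac B"
  have A': "A' \<in> carrier_mat r r" and B': "B' \<in> carrier_mat s s"
    using A B by (auto simp: A'_def B'_def)
  have dim: "dim_C A B = dim_C A' B'" unfolding A'_def B'_def by (rule dim_C_to_ac[OF A B, symmetric])
  obtain as where as: "jordan_nf A' as" using alg_closed_jordan_nf_exists[OF A'] by blast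
  obtain bs where bs: "jordan_nf B' bs" using alg_closed_jordan_nf_exists[OF B'] by blast
  define J where "J = jordan_matrix as"
  define K where "K = jordan_matrix bs"
  have simA: "similar_mat A' J" and simB: "similar_mat B' K"
    using as bs unfolding jordan_nf_def J_def K_def by auto
  have J: "J \<in> carrier_mat r r"
    using simA similar_mat_witD2(5)[OF A'] unfolding similar_mat_def by blast
  have K: "K \<in> carrier_mat s s"
    using simB similar_mat_witD2(5)[OF B'] unfolding similar_mat_def by blast
  have utJ: "upper_triangular J" and utK: "upper_triangular K"
    unfolding J_def K_def upper_triangular_def by (auto intro: jordan_matrix_upper_triangular)
  note mA = jordan_nf_multiplicities[OF A' as, folded J_def]
  note mB = jordan_nf_multiplicities[OF B' bs, folded K_def]
  \<comment> \<open>\<open>U\<close> holds the block starts of \<open>J\<close> and \<open>W\<close>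
    the block ends of \<open>K\<close>: a column condition on one side and a row condition on the
    other, as matrix units require in order to intertwine.\<close>
  define U where "U = {i. i < r \<and> (\<forall>k<r. k \<noteq> i \<longrightarrow> J $$ (k,i) = 0)}"
  define W where "W = {j. j < s \<and> (\<forall>k<s. k \<noteq> j \<longrightarrow> K $$ (j,k) = 0)}"
  have kA: "k_eig A \<alpha> = card {i \<in> U. J $$ (i,i) = \<alpha>}" for \<alpha>
  proof -
    have "diag_positions True False J \<alpha> = {i \<in> U. J $$ (i,i) = \<alpha>}"
      using J by (auto simp: diag_positions_def U_def)
    thus ?thesis unfolding k_eig_def A'_def[symmetric] mA(2) by simp
  qed
  \<comment> \<open>Each nonempty block has one start and one end, so the ends count the dimension
    of the eigenspace of \<open>B'\<close> just as well.\<close>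
  have kB: "k_eig B \<alpha> = card {j \<in> W. K $$ (j,j) = \<alpha>}" for \<alpha>
  proof -
    have "diag_positions False True K \<alpha> = {j \<in> W. K $$ (j,j) = \<alpha>}"
      using K by (auto simp: diag_positions_def W_def)
    thus ?thesis unfolding k_eig_def B'_def[symmetric] mB(3) by simp
  qed
  have mA': "m_eig A \<alpha> = card {i \<in> {..<r}. J $$ (i,i) = \<alpha>}" for \<alpha>
  proof -
    have "diag_positions False False J \<alpha> = {i \<in> {..<r}. J $$ (i,i) = \<alpha>}"
      using J by (auto simp: diag_positions_def)
    thus ?thesis unfolding m_eig_def A'_def[symmetric] carrier_matD(1)[OF A] mA(1) by simp
  qed
  have mB': "m_eig B \<alpha> = card {j \<in> {..<s}. K $$ (j,j) = \<alpha>}" for \<alpha>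
  proof -
    have "diag_positions False False K \<alpha> = {j \<in> {..<s}. K $$ (j,j) = \<alpha>}"
      using K by (auto simp: diag_positions_def)
    thus ?thesis unfolding m_eig_def B'_def[symmetric] carrier_matD(1)[OF B] mB(1) by simp
  qed
  have "(\<Sum>\<alpha> \<in> {\<alpha>. k_eig A \<alpha> * k_eig B \<alpha> \<noteq> 0}. k_eig A \<alpha> * k_eig B \<alpha>)
      = card {(i,j). i \<in> U \<and> j \<in> W \<and> J $$ (i,i) = K $$ (j,j)}"
    by (rule card_fibre_product[symmetric, OF _ _ kA kB]) (auto simp: U_def W_def)
  also have "\<dots> \<le> dim_C A B" unfolding dim
    by (rule dim_C_ge_similar[OF A' B' simA simB]) (auto simp: U_def W_def)
  finally have lower: "(\<Sum>\<alpha> \<in> {\<alpha>. k_eig A \<alpha> * k_eig B \<alpha> \<noteq> 0}. k_eig A \<alpha> * k_eig B \<alpha>) \<le> dim_C A B" .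
  have "dim_C A B \<le> card {(i,j). i \<in> {..<r} \<and> j \<in> {..<s} \<and> J $$ (i,i) = K $$ (j,j)}"
    using dim_C_le_similar_triangular[OF A' B' simA simB utJ utK] unfolding dim by simp
  also have "\<dots> = (\<Sum>\<alpha> \<in> {\<alpha>. m_eig A \<alpha> * m_eig B \<alpha> \<noteq> 0}. m_eig A \<alpha> * m_eig B \<alpha>)"
    by (rule card_fibre_product[OF _ _ mA' mB']) auto
  finally show ?thesis using lower dim_C_rank_bounds[OF A B] by blast
qed

end
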